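(* Let $\mathsf Z(V)$ be a parallelogramic zonotope with $\dim\mathsf Z(V)\ge3$. If there exists a vertex $x_\circ$ of $\mathsf Z(V)$ such that all its neighbors are on a common hyperplane, and all the edge-classes of $\mathsf Z(V)$ are incident around $x_\circ$, then $\mathsf Z(V)\setminus x_\circ$ is indecomposable. Moreover, $\mathsf Z(V)\setminus\mathcal X$ is indecomposable for any subset $\mathcal X$ of vertices of $\mathsf Z(V)$ with $x_\circ\in\mathcal X$ and $|\mathcal X|\le\dim\mathsf Z(V)-2$ such that no two vertices of $\mathcal X$ are joined by an edge of $\mathsf Z(V)$ and every vertex of $\mathcal X$ admits a deep truncation.
   Context: For a finite set $V$ of vectors in $\mathbb R^d$, $\mathsf Z(V)=\sum_{v\in V}[0,v]$ (Minkowski sum of segments) is a zonotope; it is parallelogramic if all its $2$-faces are parallelograms, equivalently if no three vectors of $V$ lie in a common linear plane (in particular no two vectors of $V$ are parallel and $0\notin V$). For $v\in V$, the edge-class $C_v$ is the set of edges of $\mathsf Z(V)$ parallel to $v$. The edge-class $C_v$ is incident around a vertex $x$ if there is a vertex $w$ adjacent to $x$ such that the edge $xw$ belongs to $C_v$. A vertex $x$ of a polytope $\mathsf P$ of dimension at least $3$ admits a deep truncation if all vertices adjacent to $x$ lie on a common hyperplane (of the affine hull of $\mathsf P$). In that case $\mathsf P\setminus x=\mathrm{conv}(u : u\text{ vertex of }\mathsf P,\ u\ne x)$. For a set $\mathcal X$ of pairwise non-adjacent vertices each admitting a deep truncation, $\mathsf P\setminus\mathcal X$ is obtained by performing these truncations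 successively (in any order), i.e. $\mathsf P\setminus\mathcal X$ is the convex hull of the vertices of $\mathsf P$ not in $\mathcal X$. A polytope $\mathsf Q$ is a deformation of $\mathsf P$ if $\lambda\mathsf P=\mathsf Q+\mathsf R$ for some $\lambda>0$ and polytope $\mathsf R$; $\mathsf P$ is indecomposable if its only deformations are $\lambda\mathsf P+t$ with $\lambda\ge0$. *)

theory Defs
  imports "HOL-Analysis.Analysis"
begin

(* The sum is the Minkowski sum of sets (HOL-Library.Set_Algebras). *)
definition zonotope :: "'a::euclidean_space set \<Rightarrow> 'a set" where
  "zonotope V = (\<Sum>v\<in>V. closed_segment 0 v)"

definition parallelogram :: "'a::euclidean_space set \<Rightarrow> bool" where
  "parallelogram F \<longleftrightarrow>
     (\<exists>p a b. a \<noteq> b \<and> independent {a, b} \<and> F = convex hull {p, p + a, p + b, p + a + b})"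

(* The first two conditions exclude redundant generators, which the 2-faces alone cannot
   detect: replacing v by the two vectors v/3 and 2v/3, or adding 0, does not change the
   zonotope.  With them, and if V has at least three elements, the condition on the 2-faces
   says that no three vectors of V lie in a common linear plane. *)
definition parallelogramic :: "'a::euclidean_space set \<Rightarrow> bool" where
  "parallelogramic V \<longleftrightarrow>
     0 \<notin> V \<and> pairwise (\<lambda>v w. independent {v, w}) V \<and>
     (\<forall>F. F face_of zonotope V \<and> aff_dim F = 2 \<longrightarrow> parallelogram F)"

definition adjacent :: "'a::euclidean_space set \<Rightarrow> 'a \<Rightarrow> 'a \<Rightarrow> bool" where
  "adjacent P x y \<longleftrightarrow> closed_segment x y edge_of P"

definition edge_class :: "'a::euclidean_space set \<Rightarrow> 'a \<Rightarrow> 'a set set" where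
  "edge_class V v =
     {closed_segment a b | a b. closed_segment a b edge_of zonotope V \<and> b - a \<in> span {v}}"

definition incident_around :: "'a::euclidean_space set \<Rightarrow> 'a \<Rightarrow> 'a \<Rightarrow> bool" where
  "incident_around V v x \<longleftrightarrow>
     (\<exists>w. adjacent (zonotope V) x w \<and> closed_segment x w \<in> edge_class V v)"

(* H is a hyperplane of the affine hull of P, which need not be the whole space. *)
definition admits_deep_truncation :: "'a::euclidean_space set \<Rightarrow> 'a \<Rightarrow> bool" where
  "admits_deep_truncation P x \<longleftrightarrow>
     aff_dim P \<ge> 3 \<and> x extreme_point_of P \<and>
     (\<exists>H. affine H \<and> H \<subseteq> affine hull P \<and> aff_dim H = aff_dim P - 1 \<and>
          (\<forall>y. adjacent P x y \<longrightarrow> y \<in> H))"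

definition deep_truncation :: "'a::euclidean_space set \<Rightarrow> 'a set \<Rightarrow> 'a set" where
  "deep_truncation P X = convex hull {u. u extreme_point_of P \<and> u \<notin> X}"

(* The library counts the empty set as a polytope; here polytopes are nonempty. *)
definition deformation_of :: "'a::euclidean_space set \<Rightarrow> 'a set \<Rightarrow> bool" where
  "deformation_of Q P \<longleftrightarrow>
     polytope Q \<and> Q \<noteq> {} \<and>
     (\<exists>c::real. \<exists>R. c > 0 \<and> polytope R \<and> R \<noteq> {} \<and> (\<lambda>x. c *\<^sub>R x) ` P = Q + R)"

definition indecomposable :: "'a::euclidean_space set \<Rightarrow> bool" where
  "indecomposable P \<longleftrightarrow>
     polytope P \<and> P \<noteq> {} \<and>
     (\<forall>Q. deformation_of Q P \<longrightarrow> (\<exists>c::real. \<exists>t. c \<ge> 0 \<and> Q = (\<lambda>x. c *\<^sub>R x + t) ` P))"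

end

theory Submission
  imports Defs
begin

text \<open>The vertices of the zonotope are the subset sums \<open>\<Sum>{v \<in> V. 0 < g \<bullet> v}\<close> for generic \<open>g\<close>.
  A deformation \<open>Q\<close> of the truncated zonotope \<open>P\<close> is the convex hull of points \<open>q u\<close>, one for each
  vertex \<open>u\<close> of \<open>P\<close>, and \<open>q u\<close> maximizes on \<open>Q\<close> every functional that \<open>u\<close> maximizes on \<open>P\<close>; hence an
  edge in direction \<open>v\<close> avoiding \<open>X\<close> is scaled by some factor.  Opposite edges of a parallelogram
  avoiding \<open>X\<close> have the same factor.  The edges in direction \<open>v\<close> are the vertices of the zonotope
  projected along \<open>v\<close>, whose graph stays connected after removing \<open>card X \<le> d - 2\<close> vertices by
  Balinski's theorem, so there is one factor \<open>\<rho> v\<close> for each \<open>v\<close>.  Balinski's theorem for the zonotope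
  itself then gives \<open>q (\<Sum>A) = t + (\<Sum>v\<in>A. \<rho> v *\<^sub>R v)\<close>.  Finally, the hyperplane through the neighbours
  of \<open>x\<^sub>0\<close> supports \<open>P\<close>, so its functional takes the same value on the images of all these neighbours;
  as every direction occurs there, this forces all \<open>\<rho> v\<close> to be equal.\<close>

subsection \<open>Connectivity of graphs of zonotopes\<close>

definition positives :: "'a::euclidean_space set \<Rightarrow> 'a \<Rightarrow> 'a set" where
  "positives W g = {w \<in> W. 0 < g \<bullet> w}"

definition generic :: "'a::euclidean_space set \<Rightarrow> 'a \<Rightarrow> bool" where
  "generic W g \<longleftrightarrow> (\<forall>w\<in>W. g \<bullet> w \<noteq> 0)"

text \<open>The chambers of the arrangement of hyperplanes in \<open>L\<close> with normals in
  \<open>W\<close>. Each is recorded by the positive part of its sign vector, which determines the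
  rest because no sign vanishes. The parameter \<open>L\<close> lets the same results serve the
  zonotope, with \<open>L = span V\<close>, and its projection along \<open>v\<close>, with
  \<open>L\<close> the part of \<open>span V\<close> orthogonal to \<open>v\<close>.\<close>

definition topes :: "'a::euclidean_space set \<Rightarrow> 'a set \<Rightarrow> 'a set set" where
  "topes L W = positives W ` {g \<in> L. generic W g}"

lemma topesI: "g \<in> L \<Longrightarrow> generic W g \<Longrightarrow> positives W g \<in> topes L W"
  by (auto simp: topes_def)

lemma topesE:
  assumes "A \<in> topes L W"
  obtains g where "g \<in> L" "generic W g" "A = positives W g"
  using assms by (auto simp: topes_def)

lemma topes_subset: "A \<in> topes L W \<Longrightarrow> A \<subseteq> W"
  by (auto simp: topes_def positives_def)

lemma positives_cong: "(\<And>w. w \<in> W \<Longrightarrow> sgn (g \<bullet> w) = sgn (h \<bullet> w)) \<Longrightarrow> positives W g = positives W h"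
  unfolding positives_def by (rule Collect_cong) (metis sgn_greater)

section \<open>Small perturbations of functionals\<close>

lemma eventually_sgn_line:
  fixes g e :: "'a::euclidean_space"
  assumes "finite W"
  shows "\<forall>\<^sub>F t in nhds s. \<forall>w\<in>W. (g + s *\<^sub>R e) \<bullet> w \<noteq> 0 \<longrightarrow>
           sgn ((g + t *\<^sub>R e) \<bullet> w) = sgn ((g + s *\<^sub>R e) \<bullet> w)"
proof (rule eventually_ball_finite[OF assms], rule ballI)
  fix w
  have lim: "((\<lambda>t. (g + t *\<^sub>R e) \<bullet> w) \<longlongrightarrow> (g + s *\<^sub>R e) \<bullet> w) (nhds s)"
    by (intro tendsto_intros filterlim_ident)
  consider "(g + s *\<^sub>R e) \<bullet> w > 0" | "(g + s *\<^sub>R e) \<bullet> w < 0" | "(g + s *\<^sub>R e) \<bullet> w = 0"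
    by linarith
  then show "\<forall>\<^sub>F t in nhds s. (g + s *\<^sub>R e) \<bullet> w \<noteq> 0 \<longrightarrow>
               sgn ((g + t *\<^sub>R e) \<bullet> w) = sgn ((g + s *\<^sub>R e) \<bullet> w)"
  proof cases
    case 1
    show ?thesis using order_tendstoD(1)[OF lim 1] by eventually_elim (use 1 in simp)
  next
    case 2
    show ?thesis using order_tendstoD(2)[OF lim 2] by eventually_elim (use 2 in simp)
  qed simp
qed

lemma exists_sgn_perturbation:
  fixes g l :: "'a::euclidean_space"
  assumes "finite W"
  obtains \<epsilon> where "\<epsilon> > 0"
    "\<And>w t. w \<in> W \<Longrightarrow> g \<bullet> w \<noteq> 0 \<Longrightarrow> \<bar>t\<bar> \<le> \<epsilon> \<Longrightarrow> sgn ((g + t *\<^sub>R l) \<bullet> w) = sgn (g \<bullet> w)"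
proof -
  obtain d where d: "d > 0" "\<And>t. dist t 0 < d \<Longrightarrow>
      \<forall>w\<in>W. g \<bullet> w \<noteq> 0 \<longrightarrow> sgn ((g + t *\<^sub>R l) \<bullet> w) = sgn (g \<bullet> w)"
    using eventually_sgn_line[OF assms, where s = 0 and g = g and e = l]
    unfolding eventually_nhds_metric by auto
  show thesis
    by (rule that[of "d/2"]) (use d in \<open>auto simp: dist_real_def\<close>)
qed

lemma exists_generic_perturbation:
  fixes g :: "'a::euclidean_space"
  assumes "finite W" "finite N" "subspace L" "g \<in> L"
    and "\<And>n. n \<in> N \<Longrightarrow> \<exists>l\<in>L. l \<bullet> n \<noteq> 0"
  shows "\<exists>g'\<in>L. (\<forall>w\<in>W. g \<bullet> w \<noteq> 0 \<longrightarrow> sgn (g' \<bullet> w) = sgn (g \<bullet> w)) \<and> generic N g'"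
  using assms(2,5)
proof (induction N rule: finite_induct)
  case empty
  then show ?case using assms by (auto simp: generic_def)
next
  case (insert n N)
  then obtain g' where g': "g' \<in> L" "\<forall>w\<in>W. g \<bullet> w \<noteq> 0 \<longrightarrow> sgn (g' \<bullet> w) = sgn (g \<bullet> w)" "generic N g'"
    by auto
  obtain l where l: "l \<in> L" "l \<bullet> n \<noteq> 0" using insert.prems by auto
  show ?case
  proof (cases "g' \<bullet> n = 0")
    case False
    then show ?thesis using g' by (auto simp: generic_def)
  next
    case True
    \<comment> \<open>The perturbation must keep the signs on \<open>N\<close> as well as those on
      \<open>W\<close>, so that the vectors already treated stay off zero.\<close>
    have "finite (W \<union> N)" using assms insert by simp
    from exists_sgn_perturbation[OF this, of g' l] obtain \<epsilon> where \<epsilon>: "\<epsilon> > 0"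
      "\<And>w t. w \<in> W \<union> N \<Longrightarrow> g' \<bullet> w \<noteq> 0 \<Longrightarrow> \<bar>t\<bar> \<le> \<epsilon> \<Longrightarrow> sgn ((g' + t *\<^sub>R l) \<bullet> w) = sgn (g' \<bullet> w)"
      by metis
    let ?g = "g' + \<epsilon> *\<^sub>R l"
    have s: "sgn (?g \<bullet> w) = sgn (g' \<bullet> w)" if "w \<in> W \<union> N" "g' \<bullet> w \<noteq> 0" for w
      using \<epsilon>(2)[OF that, of \<epsilon>] \<epsilon>(1) by auto
    have "?g \<in> L" using g' l assms by (simp add: subspace_add subspace_scale)
    moreover have "\<forall>w\<in>W. g \<bullet> w \<noteq> 0 \<longrightarrow> sgn (?g \<bullet> w) = sgn (g \<bullet> w)"
      using g'(2) s by (metis UnI1 sgn_zero_iff)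
    moreover have "generic (insert n N) ?g"
      unfolding generic_def
    proof
      fix w assume "w \<in> insert n N"
      then consider "w = n" | "w \<in> N" by auto
      then show "?g \<bullet> w \<noteq> 0"
      proof cases
        case 1 then show ?thesis using True l \<epsilon>(1) by (simp add: inner_add_left)
      next
        case 2 then show ?thesis using s[of w] g'(3) unfolding generic_def by (metis UnI2 sgn_zero_iff)
      qed
    qed
    ultimately show ?thesis by blast
  qed
qed

text \<open>Along the segment the tope changes at no more than finitely many parameters, and
  \<open>simple\<close> makes each change the crossing of a single wall, where \<open>wall\<close>
  keeps \<open>\<Phi>\<close> fixed. Local constancy spreads over the interval because it is
  connected.\<close>

lemma tope_path_invariant:
  fixes g e :: "'a::euclidean_space"
  assumes W: "finite W" and L: "subspace L" "g \<in> L" "e \<in> L" and T: "0 \<le> T"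
    and gen: "generic W g" "generic W (g + T *\<^sub>R e)"
    and simple: "\<And>t w w'. \<lbrakk>0 \<le> t; t \<le> T; w \<in> W; w' \<in> W; w \<noteq> w'; (g + t *\<^sub>R e) \<bullet> w = 0\<rbrakk>
                   \<Longrightarrow> (g + t *\<^sub>R e) \<bullet> w' \<noteq> 0"
    and wall: "\<And>w A. \<lbrakk>w \<in> W; w \<notin> A; A \<in> topes L W - B; insert w A \<in> topes L W - B\<rbrakk>
                   \<Longrightarrow> \<Phi> A = \<Phi> (insert w A)"
    and avoid: "\<And>t. \<lbrakk>0 \<le> t; t \<le> T; generic W (g + t *\<^sub>R e)\<rbrakk> \<Longrightarrow> positives W (g + t *\<^sub>R e) \<notin> B"
  shows "\<Phi> (positives W g) = \<Phi> (positives W (g + T *\<^sub>R e))"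
proof -
  let ?y = "\<lambda>t. g + t *\<^sub>R e"
  let ?R = "\<lambda>s t. \<Phi> (positives W (?y s)) = \<Phi> (positives W (?y t))"
  have yL: "?y t \<in> L" for t using L by (simp add: subspace_add subspace_scale)
  have fin: "finite {t. \<not> generic W (?y t)}"
  proof -
    have "{t. \<not> generic W (?y t)} \<subseteq> (\<lambda>w. - (g \<bullet> w) / (e \<bullet> w)) ` W"
    proof
      fix t assume "t \<in> {t. \<not> generic W (?y t)}"
      then obtain w where w: "w \<in> W" "g \<bullet> w + t * (e \<bullet> w) = 0" 
        by (auto simp: generic_def inner_add_left)
      have "g \<bullet> w \<noteq> 0" using gen w by (auto simp: generic_def)
      then have "e \<bullet> w \<noteq> 0" using w by auto
      then have "t = - (g \<bullet> w) / (e \<bullet> w)" using w by (simp add: field_simps add_eq_0_iff)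
      then show "t \<in> (\<lambda>w. - (g \<bullet> w) / (e \<bullet> w)) ` W" using w by auto
    qed
    then show ?thesis using W finite_surj by blast
  qed
  show ?thesis
  proof (cases "T = 0")
    case True then show ?thesis by simp
  next
    case False
    then have T: "0 < T" using T by simp
    have "?R 0 T"
    proof (rule connected_equivalence_relation_gen[where S = "{0..T}" and P = "\<lambda>t. generic W (?y t)" and R = ?R])
      show "connected {0..T}" by simp
      \<comment> \<open>Generic parameters are dense: a nonempty relatively open subset of the
        interval is infinite, and only finitely many parameters are not generic.\<close>
      show "\<exists>z. z \<in> S \<and> generic W (?y z)" if S: "openin (top_of_set {0..T}) S" and a: "a \<in> S" for S a
      proof -
        obtain U where U: "open U" "S = {0..T} \<inter> U" using S by (auto simp: openin_open)
        have "a islimpt {0..T}" using a U T by (auto intro!: connected_imp_perfect simp: )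
        then have "infinite S"
          unfolding U(2) using U a
          by (metis Int_iff inf_commute infinite_super islimpt_eq_acc_point order_refl)
        then have "\<not> S \<subseteq> {t. \<not> generic W (?y t)}" using fin finite_subset by blast
        then show ?thesis by blast
      qed
      show "\<exists>S. openin (top_of_set {0..T}) S \<and> a \<in> S \<and>
             (\<forall>x\<in>S. \<forall>y\<in>S. generic W (?y x) \<and> generic W (?y y) \<longrightarrow> ?R x y)" if a: "a \<in> {0..T}" for a
      proof -
        obtain U where U: "open U" "a \<in> U" "\<And>t w. \<lbrakk>t \<in> U; w \<in> W; ?y a \<bullet> w \<noteq> 0\<rbrakk> \<Longrightarrow>
            sgn (?y t \<bullet> w) = sgn (?y a \<bullet> w)"
          using eventually_sgn_line[OF W, where s = a and g = g and e = e] unfolding eventually_nhds by metis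
        have "?R x y" if xy: "x \<in> {0..T} \<inter> U" "y \<in> {0..T} \<inter> U" "generic W (?y x)" "generic W (?y y)" for x y
        proof -
          have ok: "positives W (?y t) \<in> topes L W - B" if "t \<in> {x,y}" for t
            using xy that avoid yL by (auto intro!: topesI)
          show ?thesis
          proof (cases "generic W (?y a)")
            case True
            then have "positives W (?y t) = positives W (?y a)" if "t \<in> U" for t
              using U(3) that by (intro positives_cong) (auto simp: generic_def)
            then show ?thesis using xy by auto
          next
            case False
            then obtain w where w: "w \<in> W" "?y a \<bullet> w = 0" by (auto simp: generic_def)
            let ?A = "positives W (?y a)"
            have wA: "w \<notin> ?A" using w by (auto simp: positives_def)
            \<comment> \<open>Near \<open>a\<close> the signs at all vectors other than
              \<open>w\<close> are frozen, so only the membership of \<open>w\<close> can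
              vary.\<close>
            have dich: "positives W (?y t) = ?A \<or> positives W (?y t) = insert w ?A" if "t \<in> U" for t
            proof -
              have *: "u \<in> positives W (?y t) \<longleftrightarrow> u \<in> ?A" if "u \<noteq> w" for u
              proof (cases "u \<in> W")
                case True
                then have "?y a \<bullet> u \<noteq> 0" using simple[of a w u] w a that by auto
                then have "sgn (?y t \<bullet> u) = sgn (?y a \<bullet> u)" using U(3) \<open>t \<in> U\<close> True by auto
                then show ?thesis unfolding positives_def by (metis (mono_tags, lifting) mem_Collect_eq sgn_greater)
              qed (auto simp: positives_def)
              show ?thesis
              proof (cases "w \<in> positives W (?y t)")
                case True
                then have "positives W (?y t) = insert w ?A" using * by (intro set_eqI) (metis insert_iff)
                then show ?thesis by simp
              next
                case False
                then have "positives W (?y t) = ?A" using * wA by (intro set_eqI) metis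
                then show ?thesis by simp
              qed
            qed
            have **: "\<Phi> P = \<Phi> Q" if "P = ?A \<or> P = insert w ?A" "Q = ?A \<or> Q = insert w ?A"
              "P \<in> topes L W - B" "Q \<in> topes L W - B" for P Q
              using that wall[OF w(1) wA] by (elim disjE) simp_all
            show ?thesis
              by (rule **) (use dich xy ok in blast)+
          qed
        qed
        moreover have "openin (top_of_set {0..T}) ({0..T} \<inter> U)" using U(1) by (rule openin_open_Int)
        ultimately show ?thesis using U(2) a by (intro exI[of _ "{0..T} \<inter> U"] conjI ballI impI) (blast+)
      qed
      show "generic W (?y 0)" "generic W (?y T)" using gen by simp_all
      show "?R s u" if "?R s t" "?R t u" for s t u using that by (rule trans)
    qed (use T in simp_all)
    then show ?thesis by simp
  qed
qed

section \<open>Monotone paths towards the top face of a functional\<close>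

lemma inner_sum_positives:
  assumes "finite W"
  shows "f \<bullet> \<Sum>(positives W g) = (\<Sum>w\<in>W. if 0 < g \<bullet> w then f \<bullet> w else 0)"
proof -
  have "positives W g = W \<inter> {w. 0 < g \<bullet> w}" by (auto simp: positives_def)
  then show ?thesis using assms by (simp add: inner_sum_right sum.inter_restrict if_distrib[of "inner f"] cong: if_cong)
qed

text \<open>Moving in direction \<open>f\<close>, a vector can enter the positive set only if
  \<open>f\<close> is positive on it, and leave only if \<open>f\<close> is negative on it; either
  change raises the value of \<open>f\<close>.\<close>

lemma inner_sum_positives_climb:
  fixes f g :: "'a::euclidean_space"
  assumes W: "finite W" and t: "0 \<le> t" and gen: "generic W g" "generic W (g + t *\<^sub>R f)"
    and ne: "positives W (g + t *\<^sub>R f) \<noteq> positives W g"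
  shows "f \<bullet> \<Sum>(positives W g) < f \<bullet> \<Sum>(positives W (g + t *\<^sub>R f))"
proof -
  let ?h = "g + t *\<^sub>R f"
  have up: "f \<bullet> w > 0" if "g \<bullet> w < 0" "?h \<bullet> w > 0" for w
  proof -
    have "t * (f \<bullet> w) > 0" using that by (simp add: inner_add_left)
    then show ?thesis using t by (simp add: zero_less_mult_iff)
  qed
  have down: "f \<bullet> w < 0" if "g \<bullet> w > 0" "?h \<bullet> w < 0" for w
  proof -
    have "t * (f \<bullet> w) < 0" using that by (simp add: inner_add_left)
    then show ?thesis using t by (simp add: mult_less_0_iff)
  qed
  have nz: "g \<bullet> w \<noteq> 0" "?h \<bullet> w \<noteq> 0" if "w \<in> W" for w using gen that by (auto simp: generic_def)
  obtain w where w: "w \<in> W" "(0 < g \<bullet> w) \<noteq> (0 < ?h \<bullet> w)"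
    using ne by (auto simp: positives_def)
  show ?thesis
    unfolding inner_sum_positives[OF W]
  proof (rule sum_strict_mono_ex1[OF W])
    show "\<forall>x\<in>W. (if 0 < g \<bullet> x then f \<bullet> x else 0) \<le> (if 0 < ?h \<bullet> x then f \<bullet> x else 0)"
    proof
      fix x assume "x \<in> W"
      then show "(if 0 < g \<bullet> x then f \<bullet> x else 0) \<le> (if 0 < ?h \<bullet> x then f \<bullet> x else 0)"
        using nz[of x] up[of x] down[of x] by (smt (verit))
    qed
    show "\<exists>x\<in>W. (if 0 < g \<bullet> x then f \<bullet> x else 0) < (if 0 < ?h \<bullet> x then f \<bullet> x else 0)"
      using w nz[of w] up[of w] down[of w] by (intro bexI[of _ w]) (smt (verit), simp)
  qed
qed

text \<open>The half of Balinski's argument above the level \<open>c\<close>. From both topes one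
  climbs in direction \<open>f\<close>, rising above the level \<open>c\<close> of the removed topes
  at the first change, until \<open>f\<close> dictates every sign where it does not vanish. The two
  topes reached lie in the top face of \<open>f\<close>, strictly above \<open>c\<close>, and a
  straight segment joins them there.\<close>

lemma tope_upper_half_connected:
  fixes f :: "'a::euclidean_space"
  assumes W: "finite W" and L: "subspace L"
    and nonpar: "\<And>w w' \<alpha> \<beta>. \<lbrakk>w \<in> W; w' \<in> W; w \<noteq> w'; \<alpha> \<noteq> 0 \<or> \<beta> \<noteq> 0\<rbrakk>
                   \<Longrightarrow> \<exists>l\<in>L. l \<bullet> (\<alpha> *\<^sub>R w + \<beta> *\<^sub>R w') \<noteq> 0"
    and wall: "\<And>w A. \<lbrakk>w \<in> W; w \<notin> A; A \<in> topes L W - B; insert w A \<in> topes L W - B\<rbrakk>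
                   \<Longrightarrow> \<Phi> A = \<Phi> (insert w A)"
    and f: "f \<in> L" and B: "\<And>A. A \<in> B \<Longrightarrow> f \<bullet> \<Sum>A = c" and c: "c < f \<bullet> \<Sum>(positives W f)"
    and A: "A \<in> topes L W - B" "c \<le> f \<bullet> \<Sum>A" and A': "A' \<in> topes L W - B" "c \<le> f \<bullet> \<Sum>A'"
  shows "\<Phi> A = \<Phi> A'"
proof -
  \<comment> \<open>Vectors to be avoided. If \<open>g\<close> is orthogonal to none in
    \<open>?N1\<close>, the ray from \<open>g\<close> in direction \<open>f\<close> never meets two
    walls at once. If \<open>g'\<close> is orthogonal to none in \<open>?N2 g\<close>, neither does
    the segment from \<open>g\<close> to \<open>g'\<close>.\<close>
  let ?N1 = "(\<lambda>(w,w'). (f \<bullet> w') *\<^sub>R w + (- (f \<bullet> w)) *\<^sub>R w') ` 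
               {(w,w'). w \<in> W \<and> w' \<in> W \<and> w \<noteq> w' \<and> (f \<bullet> w \<noteq> 0 \<or> f \<bullet> w' \<noteq> 0)}"
  let ?N2 = "\<lambda>g. (\<lambda>(w,w'). (- (g \<bullet> w')) *\<^sub>R w + (g \<bullet> w) *\<^sub>R w') ` 
               {(w,w'). w \<in> W \<and> w' \<in> W \<and> w \<noteq> w'}"
  have WW: "finite {(w,w'). w \<in> W \<and> w' \<in> W \<and> Q w w'}" for Q
    by (rule finite_subset[of _ "W \<times> W"]) (use W in auto)
  have fN1: "finite ?N1" using WW by simp
  have fN2: "finite (?N2 g)" for g using WW[of "\<lambda>w w'. w \<noteq> w'"] by simp
  have N1: "\<exists>l\<in>L. l \<bullet> n \<noteq> 0" if n: "n \<in> ?N1" for n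
  proof -
    obtain w w' where w: "w \<in> W" "w' \<in> W" "w \<noteq> w'" "f \<bullet> w \<noteq> 0 \<or> f \<bullet> w' \<noteq> 0"
      and n: "n = (f \<bullet> w') *\<^sub>R w + (- (f \<bullet> w)) *\<^sub>R w'" using n by auto
    show ?thesis unfolding n by (rule nonpar) (use w in auto)
  qed
  have N2: "\<exists>l\<in>L. l \<bullet> n \<noteq> 0" if g: "generic W g" and n: "n \<in> ?N2 g" for g n
  proof -
    obtain w w' where w: "w \<in> W" "w' \<in> W" "w \<noteq> w'"
      and n: "n = (- (g \<bullet> w')) *\<^sub>R w + (g \<bullet> w) *\<^sub>R w'" using n by auto
    show ?thesis unfolding n by (rule nonpar) (use w g in \<open>auto simp: generic_def\<close>)
  qed
  have lift: "\<exists>g\<in>L. generic W g \<and> positives W g = C \<and> generic N g"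
    if C: "C \<in> topes L W" and N: "finite N" "\<And>n. n \<in> N \<Longrightarrow> \<exists>l\<in>L. l \<bullet> n \<noteq> 0" for C N
  proof -
    obtain g where g: "g \<in> L" "generic W g" "C = positives W g" using C by (rule topesE)
    obtain g' where g': "g' \<in> L" "\<forall>w\<in>W. g \<bullet> w \<noteq> 0 \<longrightarrow> sgn (g' \<bullet> w) = sgn (g \<bullet> w)" "generic N g'"
      using exists_generic_perturbation[OF W N(1) L g(1) N(2)] by blast
    have s: "sgn (g' \<bullet> w) = sgn (g \<bullet> w)" if "w \<in> W" for w using g g' that by (auto simp: generic_def)
    have "generic W g'" using s g(2) unfolding generic_def by (metis sgn_zero_iff)
    moreover have "positives W g' = C" unfolding g(3) by (rule positives_cong) (rule s)
    ultimately show ?thesis using g' by auto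
  qed
  have climb: "\<Phi> (positives W g) = \<Phi> (positives W (g + T *\<^sub>R f))"
    if g: "g \<in> L" "generic W g" "generic ?N1 g" "positives W g \<notin> B" "c \<le> f \<bullet> \<Sum>(positives W g)"
      and T: "0 \<le> T" "generic W (g + T *\<^sub>R f)" for g T
  proof (rule tope_path_invariant[OF W L g(1) f T(1) g(2) T(2) _ wall])
    fix t w w' assume t: "0 \<le> t" "t \<le> T" and w: "w \<in> W" "w' \<in> W" "w \<noteq> w'" and z: "(g + t *\<^sub>R f) \<bullet> w = 0"
    show "(g + t *\<^sub>R f) \<bullet> w' \<noteq> 0"
    proof
      assume z': "(g + t *\<^sub>R f) \<bullet> w' = 0"
      have gw: "g \<bullet> w = - t * (f \<bullet> w)" "g \<bullet> w' = - t * (f \<bullet> w')"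
        using z z' by (simp_all add: inner_add_left)
      have "g \<bullet> w \<noteq> 0" using g w by (auto simp: generic_def)
      then have "f \<bullet> w \<noteq> 0" using gw by auto
      then have "(f \<bullet> w') *\<^sub>R w + (- (f \<bullet> w)) *\<^sub>R w' \<in> ?N1" using w by auto
      then have "g \<bullet> ((f \<bullet> w') *\<^sub>R w + (- (f \<bullet> w)) *\<^sub>R w') \<noteq> 0" using g(3) unfolding generic_def by blast
      moreover have "g \<bullet> ((f \<bullet> w') *\<^sub>R w + (- (f \<bullet> w)) *\<^sub>R w') = 0"
        by (simp add: inner_add_right gw algebra_simps)
      ultimately show False by simp
    qed
  next
    fix t assume t: "0 \<le> t" "t \<le> T" "generic W (g + t *\<^sub>R f)"
    show "positives W (g + t *\<^sub>R f) \<notin> B"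
    \<comment> \<open>As long as the tope is that of \<open>g\<close>, it is outside
      \<open>B\<close> by assumption; after the first change its value exceeds \<open>c\<close>, the
      value of every member of \<open>B\<close>.\<close>
    proof (cases "positives W (g + t *\<^sub>R f) = positives W g")
      case False
      from inner_sum_positives_climb[OF W t(1) g(2) t(3) False] B g(5) show ?thesis by force
    qed (use g in simp)
  qed
  obtain g where g: "g \<in> L" "generic W g" "positives W g = A" "generic ?N1 g"
    using lift[OF _ fN1 N1, of A] A by auto
  have "finite (?N1 \<union> ?N2 g)" using fN1 fN2 by simp
  moreover have "\<exists>l\<in>L. l \<bullet> n \<noteq> 0" if "n \<in> ?N1 \<union> ?N2 g" for n
    using that N1 N2[OF g(2)] by blast
  ultimately have "\<exists>g'\<in>L. generic W g' \<and> positives W g' = A' \<and> generic (?N1 \<union> ?N2 g) g'"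
    using A' by (intro lift) auto
  then obtain g' where g': "g' \<in> L" "generic W g'" "positives W g' = A'" "generic (?N1 \<union> ?N2 g) g'" by auto
  then have g'N: "generic ?N1 g'" "generic (?N2 g) g'" unfolding generic_def by blast+
  \<comment> \<open>A large \<open>T\<close> makes \<open>T *\<^sub>R f\<close> outweigh
    \<open>g\<close> and \<open>g'\<close> on every \<open>w\<close> with
    \<open>f \<bullet> w \<noteq> 0\<close>. For \<open>f \<bullet> w = 0\<close> the quotients are
    0, so the bound is harmless.\<close>
  have "\<forall>\<^sub>F T in at_top. \<forall>w\<in>W. \<bar>g \<bullet> w\<bar> / \<bar>f \<bullet> w\<bar> < T \<and> \<bar>g' \<bullet> w\<bar> / \<bar>f \<bullet> w\<bar> < T"
    using W by (intro eventually_ball_finite ballI eventually_conj eventually_gt_at_top) auto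
  with eventually_gt_at_top[of "0::real"]
  have "\<forall>\<^sub>F T in at_top. 0 < T \<and> (\<forall>w\<in>W. \<bar>g \<bullet> w\<bar> / \<bar>f \<bullet> w\<bar> < T \<and> \<bar>g' \<bullet> w\<bar> / \<bar>f \<bullet> w\<bar> < T)"
    by eventually_elim simp
  then obtain T where T: "0 < T" "\<And>w. w \<in> W \<Longrightarrow> \<bar>g \<bullet> w\<bar> / \<bar>f \<bullet> w\<bar> < T \<and> \<bar>g' \<bullet> w\<bar> / \<bar>f \<bullet> w\<bar> < T"
    using eventually_happens'[OF trivial_limit_at_top_linorder] by blast
  let ?y = "\<lambda>s. (g + T *\<^sub>R f) + s *\<^sub>R (g' - g)"
  have y: "?y s \<bullet> w = (1 - s) * (g \<bullet> w) + s * (g' \<bullet> w) + T * (f \<bullet> w)" for s w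
    by (simp add: algebra_simps)
  have ysgn: "sgn (?y s \<bullet> w) = sgn (f \<bullet> w)" if s: "0 \<le> s" "s \<le> 1" and w: "w \<in> W" "f \<bullet> w \<noteq> 0" for s w
  proof -
    have "\<bar>g \<bullet> w\<bar> < T * \<bar>f \<bullet> w\<bar>" "\<bar>g' \<bullet> w\<bar> < T * \<bar>f \<bullet> w\<bar>" 
      using T(2)[OF w(1)] w(2) by (simp_all add: divide_less_eq)
    then have "\<bar>(1 - s) * (g \<bullet> w) + s * (g' \<bullet> w)\<bar> < T * \<bar>f \<bullet> w\<bar>"
    proof -
      assume a: "\<bar>g \<bullet> w\<bar> < T * \<bar>f \<bullet> w\<bar>" "\<bar>g' \<bullet> w\<bar> < T * \<bar>f \<bullet> w\<bar>"
      have "(1 - s) * (g \<bullet> w) + s * (g' \<bullet> w) < T * \<bar>f \<bullet> w\<bar>"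
        using convex_bound_lt[of "g \<bullet> w" "T * \<bar>f \<bullet> w\<bar>" "g' \<bullet> w" "1 - s" s] a s by auto
      moreover have "(1 - s) * (- (g \<bullet> w)) + s * (- (g' \<bullet> w)) < T * \<bar>f \<bullet> w\<bar>"
        using convex_bound_lt[of "- (g \<bullet> w)" "T * \<bar>f \<bullet> w\<bar>" "- (g' \<bullet> w)" "1 - s" s] a s by auto
      ultimately show ?thesis by linarith
    qed
    then have "\<bar>?y s \<bullet> w - T * (f \<bullet> w)\<bar> < \<bar>T * (f \<bullet> w)\<bar>" unfolding y using T(1) by (simp add: abs_mult)
    then have "sgn (?y s \<bullet> w) = sgn (T * (f \<bullet> w))" by (auto simp: sgn_if split: if_splits)
    then show ?thesis using T(1) by (simp add: sgn_mult)
  qed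
  have gen0: "generic W (g + T *\<^sub>R f)" 
    unfolding generic_def
  proof
    fix w assume w: "w \<in> W"
    show "(g + T *\<^sub>R f) \<bullet> w \<noteq> 0"
    proof (cases "f \<bullet> w = 0")
      case True then show ?thesis using g w by (auto simp: generic_def inner_add_left)
    next
      case False then show ?thesis using ysgn[of 0 w] w by (simp add: sgn_if split: if_splits)
    qed
  qed
  have y1: "?y 1 = g' + T *\<^sub>R f" by simp
  have gen1: "generic W (g' + T *\<^sub>R f)" 
    unfolding generic_def
  proof
    fix w assume w: "w \<in> W"
    show "(g' + T *\<^sub>R f) \<bullet> w \<noteq> 0"
    proof (cases "f \<bullet> w = 0")
      case True then show ?thesis using g' w by (auto simp: generic_def inner_add_left)
    next
      case False then show ?thesis using ysgn[of 1 w] w unfolding y1 by (simp add: sgn_if split: if_splits)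
    qed
  qed
  have "\<Phi> A = \<Phi> (positives W (g + T *\<^sub>R f))"
    using climb[OF g(1,2,4) _ _ less_imp_le[OF T(1)] gen0] A unfolding g(3) by auto
  also have "\<dots> = \<Phi> (positives W (?y 1))"
  proof (rule tope_path_invariant[OF W L _ _ _ gen0 _ _ wall])
    show "g + T *\<^sub>R f \<in> L" "g' - g \<in> L"
      using g g' f L by (auto simp: subspace_add subspace_scale subspace_diff)
    show "generic W (g + T *\<^sub>R f + 1 *\<^sub>R (g' - g))" using gen1 unfolding y1[symmetric] .
  next
    fix s w w' assume s: "0 \<le> s" "s \<le> 1" and w: "w \<in> W" "w' \<in> W" "w \<noteq> w'" and z: "?y s \<bullet> w = 0"
    show "?y s \<bullet> w' \<noteq> 0"
    proof
      assume z': "?y s \<bullet> w' = 0"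
      \<comment> \<open>Two walls could meet only where \<open>f\<close> vanishes on both vectors.
        On such vectors the path looks like the segment from \<open>g\<close> to \<open>g'\<close>,
        which \<open>?N2 g\<close> controls.\<close>
      have fw: "f \<bullet> w = 0" "f \<bullet> w' = 0" using ysgn[OF s w(1)] ysgn[OF s w(2)] z z' by (metis sgn_zero_iff)+
      have e: "s * (g' \<bullet> w) = - (1 - s) * (g \<bullet> w)" "s * (g' \<bullet> w') = - (1 - s) * (g \<bullet> w')"
        using z z' fw unfolding y by (simp_all add: algebra_simps)
      have "s \<noteq> 0" using e(1) g(2) w unfolding generic_def by auto
      have "s * (g' \<bullet> ((- (g \<bullet> w')) *\<^sub>R w + (g \<bullet> w) *\<^sub>R w'))
            = - (g \<bullet> w') * (s * (g' \<bullet> w)) + (g \<bullet> w) * (s * (g' \<bullet> w'))"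
        by (simp add: inner_add_right algebra_simps)
      also have "\<dots> = 0" unfolding e by (simp add: algebra_simps)
      finally have "g' \<bullet> ((- (g \<bullet> w')) *\<^sub>R w + (g \<bullet> w) *\<^sub>R w') = 0" using \<open>s \<noteq> 0\<close> by simp
      moreover have "(- (g \<bullet> w')) *\<^sub>R w + (g \<bullet> w) *\<^sub>R w' \<in> ?N2 g" using w by auto
      ultimately show False using g'N(2) unfolding generic_def by blast
    qed
  next
    fix s :: real assume s: "0 \<le> s" "s \<le> 1"
    have "f \<bullet> \<Sum>(positives W (?y s)) = f \<bullet> \<Sum>(positives W f)"
      unfolding inner_sum_positives[OF W]
    proof (rule sum.cong[OF refl])
      fix w assume "w \<in> W"
      then show "(if 0 < ?y s \<bullet> w then f \<bullet> w else 0) = (if 0 < f \<bullet> w then f \<bullet> w else 0)"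
        using ysgn[OF s, of w] by (cases "f \<bullet> w = 0") (auto simp: sgn_if split: if_splits)
    qed
    then show "positives W (?y s) \<notin> B" using B c by force
  qed auto
  also have "\<dots> = \<Phi> (positives W (g' + T *\<^sub>R f))" by (simp only: y1)
  also have "\<dots> = \<Phi> A'"
    using climb[OF g'(1,2) g'N(1) _ _ less_imp_le[OF T(1)] gen1] A' unfolding g'(3) by auto
  finally show ?thesis .
qed

text \<open>The orthogonal complement of \<open>D\<close> has codimension no more than
  \<open>card D\<close>, hence meets \<open>L\<close> in positive dimension.\<close>

lemma exists_orthogonal_in_subspace:
  fixes L :: "'a::euclidean_space set"
  assumes "subspace L" "finite D" "card D < dim L"
  obtains f where "f \<in> L" "f \<noteq> 0" "\<And>d. d \<in> D \<Longrightarrow> f \<bullet> d = 0"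
proof -
  let ?O = "{y \<in> UNIV. \<forall>x\<in>span D. orthogonal x y}"
  have O: "subspace ?O" using subspace_orthogonal_to_vectors[of "span D"] by simp
  have "dim ?O + dim (span D) = dim (UNIV::'a set)"
    by (rule dim_subspace_orthogonal_to_vectors) auto
  moreover have "dim (span D) \<le> card D" using assms by (simp add: dim_le_card')
  moreover have "dim {x + y | x y. x \<in> L \<and> y \<in> ?O} + dim (L \<inter> ?O) = dim L + dim ?O"
    by (rule dim_sums_Int) (use assms O in auto)
  moreover have "dim {x + y | x y. x \<in> L \<and> y \<in> ?O} \<le> dim (UNIV::'a set)" by (rule dim_subset) simp
  ultimately have "dim (L \<inter> ?O) \<noteq> 0" using assms by linarith
  then have "\<not> L \<inter> ?O \<subseteq> {0}" by (simp only: dim_eq_0 not_False_eq_True)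
  then obtain f where f: "f \<in> L" "\<forall>x\<in>span D. orthogonal x f" "f \<noteq> 0" by blast
  show thesis
  proof (rule that[OF f(1,3)])
    fix d assume "d \<in> D"
    then have "orthogonal d f" using f(2) by (simp add: span_base)
    then show "f \<bullet> d = 0" by (simp add: orthogonal_def inner_commute)
  qed
qed

text \<open>Balinski's theorem for the graph of the zonotope generated by the projection of \<open>W\<close> to \<open>L\<close>.
  A functional \<open>f\<close> that is constant on the removed vertices and on \<open>A\<close> exists by dimension count;
  every vertex on either side of its level set through \<open>A\<close> can move monotonically to the
  corresponding extreme face of \<open>f\<close>.\<close>

lemma topes_connected:
  fixes L W :: "'a::euclidean_space set"
  assumes W: "finite W" and L: "subspace L"
    and nonpar: "\<And>w w' \<alpha> \<beta>. \<lbrakk>w \<in> W; w' \<in> W; w \<noteq> w'; \<alpha> \<noteq> 0 \<or> \<beta> \<noteq> 0\<rbrakk>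
                   \<Longrightarrow> \<exists>l\<in>L. l \<bullet> (\<alpha> *\<^sub>R w + \<beta> *\<^sub>R w') \<noteq> 0"
    and detect: "\<And>f. \<lbrakk>f \<in> L; f \<noteq> 0\<rbrakk> \<Longrightarrow> \<exists>w\<in>W. f \<bullet> w \<noteq> 0"
    and B: "finite B" "card B < dim L"
    and wall: "\<And>w A. \<lbrakk>w \<in> W; w \<notin> A; A \<in> topes L W - B; insert w A \<in> topes L W - B\<rbrakk>
                   \<Longrightarrow> \<Phi> A = \<Phi> (insert w A)"
    and A: "A \<in> topes L W - B" and A': "A' \<in> topes L W - B"
  shows "\<Phi> A = \<Phi> A'"
proof -
  \<comment> \<open>Using differences from \<open>\<Sum>A\<close> rather than the sums themselves
    makes \<open>f\<close> constant on \<open>B\<close> together with \<open>A\<close>, at the cost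
    of no more than \<open>card B\<close> conditions.\<close>
  let ?D = "(\<lambda>C. \<Sum>C - \<Sum>A) ` B"
  have "finite ?D" "card ?D < dim L"
    using B card_image_le[OF B(1), of "\<lambda>C. \<Sum>C - \<Sum>A"] by auto
  from exists_orthogonal_in_subspace[OF L this]
  obtain f where f: "f \<in> L" "f \<noteq> 0" and fD: "\<And>d. d \<in> ?D \<Longrightarrow> f \<bullet> d = 0" by blast
  define c where "c = f \<bullet> \<Sum>A"
  define M where "M = f \<bullet> \<Sum>(positives W f)"
  define m where "m = f \<bullet> \<Sum>(positives W (- f))"
  have fB: "f \<bullet> \<Sum>C = c" if "C \<in> B" for C
    using fD[of "\<Sum>C - \<Sum>A"] that by (auto simp: c_def inner_diff_right)
  have "m < M"
  proof -
    obtain w where w: "w \<in> W" "f \<bullet> w \<noteq> 0" using detect[OF f] by blast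
    show ?thesis unfolding M_def m_def inner_sum_positives[OF W]
    proof (rule sum_strict_mono_ex1[OF W])
      show "\<exists>w\<in>W. (if 0 < (- f) \<bullet> w then f \<bullet> w else 0) < (if 0 < f \<bullet> w then f \<bullet> w else 0)"
        using w by (intro bexI[of _ w]) simp_all
    qed simp
  qed
  have bounds: "m \<le> f \<bullet> \<Sum>C" "f \<bullet> \<Sum>C \<le> M" if C: "C \<in> topes L W" for C
  proof -
    obtain g where g: "C = positives W g" using C by (rule topesE)
    show "m \<le> f \<bullet> \<Sum>C" "f \<bullet> \<Sum>C \<le> M"
      unfolding M_def m_def g inner_sum_positives[OF W] by (rule sum_mono, simp)+
  qed
  have up: "\<Phi> A = \<Phi> A'" if "c < M" "c \<le> f \<bullet> \<Sum>A'"
  proof (rule tope_upper_half_connected[OF W L nonpar wall f(1) fB _ A _ A'])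
    show "c < f \<bullet> \<Sum>(positives W f)" using that by (simp add: M_def)
  qed (use that in \<open>simp_all add: c_def\<close>)
  have down: "\<Phi> A = \<Phi> A'" if "m < c" "f \<bullet> \<Sum>A' \<le> c"
  proof -
    have nf: "- f \<in> L" using f L by (simp add: subspace_neg)
    have nB: "(- f) \<bullet> \<Sum>C = - c" if "C \<in> B" for C using fB[OF that] by simp
    show ?thesis
    proof (rule tope_upper_half_connected[OF W L nonpar wall nf nB _ A _ A'])
      show "- c < (- f) \<bullet> \<Sum>(positives W (- f))" using that by (simp add: m_def)
    qed (use that in \<open>simp_all add: c_def\<close>)
  qed
  have "m \<le> c" "c \<le> M" "m \<le> f \<bullet> \<Sum>A'" "f \<bullet> \<Sum>A' \<le> M"
    using bounds A A' by (auto simp: c_def)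
  \<comment> \<open>\<open>A\<close> lies on the level \<open>c\<close> itself, so it belongs to
    both closed halves. If \<open>c\<close> is the maximum \<open>M\<close>, then \<open>A'\<close>
    lies in the lower half, and dually for \<open>m\<close>; both cannot happen because
    \<open>m < M\<close>. Otherwise either half that contains \<open>A'\<close> serves.\<close>
  then show ?thesis
    using \<open>m < M\<close> up down by linarith
qed

subsection \<open>Faces of zonotopes\<close>

lemma sum_subset_inner:
  assumes "finite V" "A \<subseteq> V"
  shows "f \<bullet> \<Sum>A = (\<Sum>v\<in>V. if v \<in> A then f \<bullet> v else 0)"
proof -
  have "A = V \<inter> A" using assms by blast
  then have "f \<bullet> \<Sum>A = (\<Sum>v\<in>V \<inter> A. f \<bullet> v)" by (simp add: inner_sum_right)
  then show ?thesis using assms by (simp add: sum.inter_restrict)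
qed

text \<open>The value of \<open>g\<close> on a subset sum splits into one contribution per vector,
  and \<open>positives V g\<close> makes the best choice at each; a wrong choice at a
  \<open>v\<close> not orthogonal to \<open>g\<close> is a strict loss.\<close>

lemma subset_sum_maximal:
  assumes V: "finite V" "A \<subseteq> V" and max: "g \<bullet> \<Sum>(positives V g) \<le> g \<bullet> \<Sum>A"
    and v: "v \<in> V" "g \<bullet> v \<noteq> 0"
  shows "v \<in> A \<longleftrightarrow> 0 < g \<bullet> v"
proof (rule ccontr)
  assume "\<not> ?thesis"
  then have "g \<bullet> \<Sum>A < g \<bullet> \<Sum>(positives V g)"
    unfolding sum_subset_inner[OF V] inner_sum_positives[OF V(1)]
    by (intro sum_strict_mono_ex1[OF V(1)] bexI[of _ v]) (use v in auto)
  then show False using max by simp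
qed

text \<open>The sum over a tope is the only maximum of its generic functional among all subset sums.
  Vertices can therefore be indexed by topes.\<close>

lemma tope_sum_inj:
  assumes V: "finite V" and A: "A \<in> topes L V" "A' \<subseteq> V" and eq: "\<Sum>A = \<Sum>A'"
  shows "A = A'"
proof -
  obtain g where g: "generic V g" "A = positives V g" using A by (blast elim: topesE)
  have "g \<bullet> \<Sum>(positives V g) \<le> g \<bullet> \<Sum>A'" using eq g by simp
  from subset_sum_maximal[OF V A(2) this] show ?thesis
    using g A(2) by (auto simp: generic_def positives_def)
qed

text \<open>Witnesses of the two topes agree in sign everywhere except at \<open>v\<close>; the
  positive combination of them that vanishes at \<open>v\<close> lies on the wall between
  them.\<close>

lemma topes_wallD:
  assumes L: "subspace L" and v: "v \<in> V" "v \<notin> A" and A: "A \<in> topes L V" "insert v A \<in> topes L V"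
  obtains g where "g \<in> L" "g \<bullet> v = 0" "generic (V - {v}) g" "positives V g = A"
proof -
  obtain a where a: "a \<in> L" "generic V a" "A = positives V a" using A(1) by (rule topesE)
  obtain b where b: "b \<in> L" "generic V b" "insert v A = positives V b" using A(2) by (rule topesE)
  define s where "s = b \<bullet> v"
  define t where "t = - (a \<bullet> v)"
  have "s > 0" using v b unfolding s_def positives_def by blast
  moreover have "\<not> 0 < a \<bullet> v" "a \<bullet> v \<noteq> 0" using v a by (auto simp: positives_def generic_def)
  ultimately have st: "s > 0" "t > 0" by (auto simp: t_def)
  let ?g = "s *\<^sub>R a + t *\<^sub>R b"
  have gv: "?g \<bullet> v = 0" by (simp add: inner_add_left inner_diff_left s_def t_def)
  have same: "0 < a \<bullet> w \<longleftrightarrow> 0 < b \<bullet> w" if "w \<in> V" "w \<noteq> v" for w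
    using that a(3) b(3) unfolding positives_def by blast
  have sg: "?g \<bullet> w \<noteq> 0 \<and> (0 < ?g \<bullet> w \<longleftrightarrow> 0 < a \<bullet> w)" if w: "w \<in> V" "w \<noteq> v" for w
  proof (cases "0 < a \<bullet> w")
    case True
    then have "0 < ?g \<bullet> w" using same[OF w] st by (simp add: inner_add_left add_pos_pos)
    then show ?thesis using True by simp
  next
    case False
    then have "a \<bullet> w < 0" "b \<bullet> w < 0" using same[OF w] a b w by (auto simp: generic_def not_less order_le_less)
    then have "?g \<bullet> w < 0" using st by (simp add: inner_add_left add_neg_neg mult_pos_neg)
    then show ?thesis using False by simp
  qed
  show thesis
  proof (rule that[of ?g])
    show "?g \<in> L" using a b L by (simp add: subspace_add subspace_scale)
    show "?g \<bullet> v = 0" by (rule gv)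
    show "generic (V - {v}) ?g" using sg by (auto simp: generic_def)
    have "w \<in> positives V ?g \<longleftrightarrow> w \<in> A" for w
    proof (cases "w = v")
      case True then show ?thesis using gv v by (simp add: positives_def)
    next
      case False then show ?thesis using sg[of w] a(3) by (auto simp: positives_def)
    qed
    then show "positives V ?g = A" by blast
  qed
qed

lemma topes_wallI:
  assumes L: "subspace L" and V: "finite V" "v \<in> V" "v \<in> L" "v \<noteq> 0"
    and g: "g \<in> L" "g \<bullet> v = 0" "generic (V - {v}) g"
  shows "positives V g \<in> topes L V" "insert v (positives V g) \<in> topes L V"
proof -
  obtain e where e: "e > 0" "\<And>w t. \<lbrakk>w \<in> V; g \<bullet> w \<noteq> 0; \<bar>t\<bar> \<le> e\<rbrakk> \<Longrightarrow>
      sgn ((g + t *\<^sub>R v) \<bullet> w) = sgn (g \<bullet> w)"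
    using exists_sgn_perturbation[OF V(1), of g v] by metis
  have vv: "(g + t *\<^sub>R v) \<bullet> v = t * (v \<bullet> v)" for t using g(2) by (simp add: inner_add_left)
  have vp: "0 < v \<bullet> v" using V by simp
  have sg: "sgn ((g + t *\<^sub>R v) \<bullet> w) = sgn (g \<bullet> w)" if "w \<in> V" "w \<noteq> v" "\<bar>t\<bar> \<le> e" for w t
    using e(2)[of w t] that g(3) by (auto simp: generic_def)
  have gen: "generic V (g + t *\<^sub>R v)" if "t \<noteq> 0" "\<bar>t\<bar> \<le> e" for t
    unfolding generic_def
  proof
    fix w assume w: "w \<in> V"
    show "(g + t *\<^sub>R v) \<bullet> w \<noteq> 0"
    proof (cases "w = v")
      case True then show ?thesis using vv[of t] vp that by simp
    next
      case False
      then have "g \<bullet> w \<noteq> 0" using w g(3) by (auto simp: generic_def)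
      then show ?thesis using sg[OF w False that(2)] by (metis sgn_zero_iff)
    qed
  qed
  have mem: "w \<in> positives V (g + t *\<^sub>R v) \<longleftrightarrow> w \<in> positives V g" if "w \<noteq> v" "\<bar>t\<bar> \<le> e" for w t
    using sg[of w t] that unfolding positives_def by (metis (mono_tags, lifting) mem_Collect_eq sgn_greater)
  have "v \<notin> positives V g" using g by (simp add: positives_def)
  moreover have "(g + (- e) *\<^sub>R v) \<bullet> v < 0" "0 < (g + e *\<^sub>R v) \<bullet> v"
    unfolding vv using e(1) vp by (simp_all add: mult_neg_pos)
  then have "v \<notin> positives V (g + (- e) *\<^sub>R v)" "v \<in> positives V (g + e *\<^sub>R v)"
    using V by (simp_all add: positives_def)
  ultimately have eq: "positives V (g + (- e) *\<^sub>R v) = positives V g"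
      "positives V (g + e *\<^sub>R v) = insert v (positives V g)"
    using mem[of _ "- e"] mem[of _ e] e(1) by (intro set_eqI; metis abs_minus_cancel abs_of_pos insert_iff order_refl)+
  have "positives V (g + t *\<^sub>R v) \<in> topes L V" if "t \<noteq> 0" "\<bar>t\<bar> \<le> e" for t
    using L g V gen[OF that] by (intro topesI subspace_add subspace_scale)
  from this[of "- e"] this[of e] show "positives V g \<in> topes L V" "insert v (positives V g) \<in> topes L V"
    unfolding eq using e(1) by simp_all
qed

text \<open>The left side describes the vertices of the projection along \<open>v\<close>, the right
  side the edges of the zonotope in direction \<open>v\<close>, each recorded by its end without
  \<open>v\<close>. This is what makes connectivity applicable to a single edge class.\<close>

lemma topes_wall_iff:
  assumes L: "subspace L" and V: "finite V" "v \<in> V" "v \<in> L" "v \<noteq> 0"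
  shows "A \<in> topes {g \<in> L. g \<bullet> v = 0} (V - {v}) \<longleftrightarrow> v \<notin> A \<and> A \<in> topes L V \<and> insert v A \<in> topes L V"
    (is "?l \<longleftrightarrow> ?r")
proof
  have eq: "positives (V - {v}) g = positives V g" if "g \<bullet> v = 0" for g
    using that by (auto simp: positives_def)
  show ?r if ?l
  proof -
    obtain g where g: "g \<in> L" "g \<bullet> v = 0" "generic (V - {v}) g" and A: "A = positives V g"
      using \<open>?l\<close> eq by (auto elim!: topesE)
    have "v \<notin> positives V g" using g by (simp add: positives_def)
    then show ?r unfolding A using topes_wallI[OF L V g] by simp
  qed
  show ?l if ?r
  proof -
    obtain g where g: "g \<in> L" "g \<bullet> v = 0" "generic (V - {v}) g" "positives V g = A"
      using topes_wallD[OF L V(2), of A] \<open>?r\<close> by blast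
    then show ?l using eq[OF g(2)] topesI[of g "{g \<in> L. g \<bullet> v = 0}" "V - {v}"] by simp
  qed
qed

section \<open>Faces and vertices of zonotopes\<close>

lemma zonotope_eq:
  assumes "finite V"
  shows "zonotope V = {\<Sum>v\<in>V. c v *\<^sub>R v | c. \<forall>v\<in>V. 0 \<le> c v \<and> c v \<le> 1}"
proof -
  have "zonotope V = {sum s V | s. \<forall>v\<in>V. s v \<in> closed_segment 0 v}"
    unfolding zonotope_def by (rule set_sum_alt[OF assms])
  also have "\<dots> = {\<Sum>v\<in>V. c v *\<^sub>R v | c. \<forall>v\<in>V. 0 \<le> c v \<and> c v \<le> 1}" (is "?L = ?R")
  proof (intro equalityI subsetI)
    fix x assume "x \<in> ?L"
    then obtain s where s: "x = sum s V" "\<forall>v\<in>V. s v \<in> closed_segment 0 v" by blast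
    have "\<forall>v\<in>V. \<exists>u. 0 \<le> u \<and> u \<le> 1 \<and> s v = u *\<^sub>R v"
      using s(2) by (auto simp: in_segment)
    then obtain c where c: "\<forall>v\<in>V. 0 \<le> c v \<and> c v \<le> 1 \<and> s v = c v *\<^sub>R v" by metis
    then have "x = (\<Sum>v\<in>V. c v *\<^sub>R v)" unfolding s(1) by (intro sum.cong) auto
    then show "x \<in> ?R" using c by blast
  next
    fix x assume "x \<in> ?R"
    then obtain c where c: "x = (\<Sum>v\<in>V. c v *\<^sub>R v)" "\<forall>v\<in>V. 0 \<le> c v \<and> c v \<le> 1" by blast
    then have "\<forall>v\<in>V. c v *\<^sub>R v \<in> closed_segment 0 v" by (auto simp: in_segment)
    then show "x \<in> ?L" using c(1) by blast
  qed
  finally show ?thesis .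
qed

lemma zonotope_empty: "zonotope {} = {0}"
  by (simp add: zonotope_eq)

lemma polytope_zonotope:
  assumes "finite V"
  shows "polytope (zonotope V)"
proof -
  have "finite {sum s V | s. \<forall>v\<in>V. s v \<in> {0, v}}"
  proof (rule finite_subset)
    show "{sum s V | s. \<forall>v\<in>V. s v \<in> {0, v}} \<subseteq> Sum ` Pow V"
    proof
      fix x assume "x \<in> {sum s V | s. \<forall>v\<in>V. s v \<in> {0, v}}"
      then obtain s where s: "x = sum s V" "\<forall>v\<in>V. s v \<in> {0, v}" by blast
      have "x = (\<Sum>v\<in>V. if s v = v then v else 0)" unfolding s(1) using s(2) by (intro sum.cong) auto
      also have "\<dots> = \<Sum>(V \<inter> {v. s v = v})" using assms by (simp add: sum.inter_restrict)
      finally show "x \<in> Sum ` Pow V" by blast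
    qed
  qed (use assms in simp)
  then have "finite (\<Sum>v\<in>V. {0, v})" by (simp only: set_sum_alt[OF assms])
  moreover have "zonotope V = convex hull (\<Sum>v\<in>V. {0, v})"
    unfolding zonotope_def convex_hull_set_sum by (simp add: segment_convex_hull)
  ultimately show ?thesis unfolding polytope_def by blast
qed

lemma zonotope_subset_span: "finite V \<Longrightarrow> zonotope V \<subseteq> span V"
  by (auto simp: zonotope_eq intro: span_sum span_scale span_base)

lemma subset_sum_in_zonotope:
  assumes "finite V" "A \<subseteq> V"
  shows "\<Sum>A \<in> zonotope V"
proof -
  have "A = V \<inter> A" using assms by blast
  then have "\<Sum>A = (\<Sum>v\<in>V \<inter> A. v)" by simp
  also have "\<dots> = (\<Sum>v\<in>V. (if v \<in> A then 1 else 0) *\<^sub>R v)"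
    using assms by (simp add: sum.inter_restrict if_distrib[of "\<lambda>c. c *\<^sub>R _"] cong: if_cong)
  finally show ?thesis unfolding zonotope_eq[OF assms(1)] 
    by (intro CollectI exI[of _ "\<lambda>v. if v \<in> A then 1 else 0"]) simp
qed

lemma aff_dim_zonotope:
  assumes "finite V"
  shows "aff_dim (zonotope V) = int (dim (span V))"
proof -
  have "V \<subseteq> zonotope V"
    using subset_sum_in_zonotope[OF assms, of "{_}"] by auto
  then have "span (zonotope V) = span V"
    by (intro subset_antisym span_minimal zonotope_subset_span[OF assms] subspace_span)
       (auto intro: span_base)
  moreover have "0 \<in> zonotope V" using subset_sum_in_zonotope[OF assms, of "{}"] by simp
  ultimately show ?thesis
    using aff_dim_zero[of "zonotope V"] dim_span[of "zonotope V"] by (simp add: hull_inc)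
qed

lemma zonotope_inner_le:
  assumes V: "finite V" and y: "y \<in> zonotope V"
  shows "g \<bullet> y \<le> g \<bullet> \<Sum>(positives V g)"
proof -
  obtain c where c: "y = (\<Sum>v\<in>V. c v *\<^sub>R v)" "\<forall>v\<in>V. 0 \<le> c v \<and> c v \<le> 1"
    using y by (auto simp: zonotope_eq[OF V])
  have "(\<Sum>v\<in>V. c v * (g \<bullet> v)) \<le> (\<Sum>v\<in>V. if 0 < g \<bullet> v then g \<bullet> v else 0)"
  proof (rule sum_mono)
    fix v assume "v \<in> V"
    then show "c v * (g \<bullet> v) \<le> (if 0 < g \<bullet> v then g \<bullet> v else 0)"
      using c(2) by (auto simp: mult_le_cancel_right1 mult_nonneg_nonpos not_less)
  qed
  then show ?thesis unfolding c(1) inner_sum_positives[OF V] by (simp add: inner_sum_right)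
qed

text \<open>Equality in \<open>zonotope_inner_le\<close> forces coefficient 1 where \<open>g\<close>
  is positive and 0 where it is negative, and leaves the coefficients of the vectors orthogonal to
  \<open>g\<close> free.\<close>

lemma zonotope_face:
  assumes V: "finite V"
  shows "zonotope V \<inter> {y. g \<bullet> y = g \<bullet> \<Sum>(positives V g)} =
           (+) (\<Sum>(positives V g)) ` zonotope {v \<in> V. g \<bullet> v = 0}"
proof -
  let ?V0 = "{v \<in> V. g \<bullet> v = 0}"
  let ?P = "positives V g"
  have V0: "finite ?V0" using V by simp
  have split: "(\<Sum>v\<in>V. c v *\<^sub>R v) = \<Sum>?P + (\<Sum>v\<in>?V0. c v *\<^sub>R v)"
    if c: "\<And>v. v \<in> V \<Longrightarrow> g \<bullet> v \<noteq> 0 \<Longrightarrow> c v = (if 0 < g \<bullet> v then 1 else 0)" for c :: "'a \<Rightarrow> real"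
  proof -
    have "(\<Sum>v\<in>V. c v *\<^sub>R v) = (\<Sum>v\<in>V. (if 0 < g \<bullet> v then v else 0) + (if g \<bullet> v = 0 then c v *\<^sub>R v else 0))"
      by (rule sum.cong) (use c in auto)
    also have "\<dots> = (\<Sum>v | v \<in> V \<and> 0 < g \<bullet> v. v) + (\<Sum>v | v \<in> V \<and> g \<bullet> v = 0. c v *\<^sub>R v)"
      using V by (simp add: sum.distrib sum.inter_filter)
    finally show ?thesis by (simp add: positives_def)
  qed
  show ?thesis
  proof (intro equalityI subsetI)
    fix y assume y: "y \<in> zonotope V \<inter> {y. g \<bullet> y = g \<bullet> \<Sum>?P}"
    then obtain c where c: "y = (\<Sum>v\<in>V. c v *\<^sub>R v)" "\<forall>v\<in>V. 0 \<le> c v \<and> c v \<le> 1"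
      by (auto simp: zonotope_eq[OF V])
    have le: "c v * (g \<bullet> v) \<le> (if 0 < g \<bullet> v then g \<bullet> v else 0)" if "v \<in> V" for v
      using c(2) that by (auto simp: mult_le_cancel_right1 mult_nonneg_nonpos not_less)
    have "(\<Sum>v\<in>V. c v * (g \<bullet> v)) = (\<Sum>v\<in>V. if 0 < g \<bullet> v then g \<bullet> v else 0)"
      using y unfolding inner_sum_positives[OF V] c(1) by (simp add: inner_sum_right)
    from sum_mono_inv[OF this le _ V] have eq: "c v * (g \<bullet> v) = (if 0 < g \<bullet> v then g \<bullet> v else 0)" if "v \<in> V" for v
      using that by blast
    have "c v = (if 0 < g \<bullet> v then 1 else 0)" if "v \<in> V" "g \<bullet> v \<noteq> 0" for v
      using eq[OF that(1)] that by (auto split: if_splits)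
    then have "y = \<Sum>?P + (\<Sum>v\<in>?V0. c v *\<^sub>R v)" unfolding c(1) by (rule split)
    moreover have "(\<Sum>v\<in>?V0. c v *\<^sub>R v) \<in> zonotope ?V0"
      unfolding zonotope_eq[OF V0] using c(2) by blast
    ultimately show "y \<in> (+) (\<Sum>?P) ` zonotope ?V0" by blast
  next
    fix y assume "y \<in> (+) (\<Sum>?P) ` zonotope ?V0"
    then obtain c where c: "y = \<Sum>?P + (\<Sum>v\<in>?V0. c v *\<^sub>R v)" "\<forall>v\<in>?V0. 0 \<le> c v \<and> c v \<le> 1"
      unfolding zonotope_eq[OF V0] by blast
    define d where "d v = (if g \<bullet> v = 0 then c v else if 0 < g \<bullet> v then 1 else 0)" for v
    have "(\<Sum>v\<in>V. d v *\<^sub>R v) = \<Sum>?P + (\<Sum>v\<in>?V0. d v *\<^sub>R v)" by (rule split) (auto simp: d_def)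
    also have "\<dots> = y" unfolding c(1) by (simp add: d_def)
    finally have "y = (\<Sum>v\<in>V. d v *\<^sub>R v)" by simp
    moreover have "\<forall>v\<in>V. 0 \<le> d v \<and> d v \<le> 1" using c(2) by (auto simp: d_def)
    ultimately have "y \<in> zonotope V" unfolding zonotope_eq[OF V] by blast
    moreover have "g \<bullet> y = g \<bullet> \<Sum>?P" unfolding c(1) by (simp add: inner_add_right inner_sum_right)
    ultimately show "y \<in> zonotope V \<inter> {y. g \<bullet> y = g \<bullet> \<Sum>?P}" by simp
  qed
qed

lemma zonotope_face_of:
  assumes "finite V"
  shows "zonotope V \<inter> {y. g \<bullet> y = g \<bullet> \<Sum>(positives V g)} face_of zonotope V"
  using polytope_zonotope[OF assms] zonotope_inner_le[OF assms]
  by (intro face_of_Int_supporting_hyperplane_le) (auto simp: polytope_imp_convex)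

lemma zonotope_face_exposed:
  assumes V: "finite V" and F: "F face_of zonotope V" "F \<noteq> {}"
  obtains g where "g \<in> span V" "F = zonotope V \<inter> {y. g \<bullet> y = g \<bullet> \<Sum>(positives V g)}"
proof -
  have "F exposed_face_of zonotope V"
    using exposed_face_of_polyhedron[OF polytope_imp_polyhedron[OF polytope_zonotope[OF V]]] F by simp
  then obtain a b where ab: "zonotope V \<subseteq> {x. a \<bullet> x \<le> b}" "F = zonotope V \<inter> {x. a \<bullet> x = b}"
    unfolding exposed_face_of_def by blast
  obtain g z where g: "g \<in> span V" "\<And>w. w \<in> span V \<Longrightarrow> orthogonal z w" "a = g + z"
    using orthogonal_subspace_decomp_exists by blast
  have ag: "a \<bullet> x = g \<bullet> x" if "x \<in> span V" for x
    using g(2)[OF that] by (simp add: g(3) orthogonal_def inner_add_left)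
  have P: "\<Sum>(positives V g) \<in> zonotope V" by (rule subset_sum_in_zonotope[OF V]) (auto simp: positives_def)
  obtain y where y: "y \<in> zonotope V" "a \<bullet> y = b" using F(2) ab by blast
  have "g \<bullet> \<Sum>(positives V g) \<le> b"
    using ab(1) P ag zonotope_subset_span[OF V] by fastforce
  moreover have "b \<le> g \<bullet> \<Sum>(positives V g)"
    using zonotope_inner_le[OF V y(1), of g] y ag zonotope_subset_span[OF V] by fastforce
  ultimately have b: "b = g \<bullet> \<Sum>(positives V g)" by simp
  have "a \<bullet> y = b \<longleftrightarrow> g \<bullet> y = g \<bullet> \<Sum>(positives V g)" if "y \<in> zonotope V" for y
    using ag[of y] zonotope_subset_span[OF V] that unfolding b by auto
  then have "F = zonotope V \<inter> {y. g \<bullet> y = g \<bullet> \<Sum>(positives V g)}" unfolding ab(2) by blast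
  with g(1) show thesis by (rule that)
qed

text \<open>By \<open>zonotope_face\<close> the face of \<open>g\<close> is a translate of the
  zonotope of the vectors orthogonal to \<open>g\<close>. As these are nonzero, the face is a point
  exactly if there are none, that is, if \<open>g\<close> is generic.\<close>

lemma zonotope_extreme_points:
  assumes V: "finite V" "0 \<notin> V"
  shows "{u. u extreme_point_of zonotope V} = Sum ` topes (span V) V"
proof (intro equalityI subsetI)
  fix u assume "u \<in> {u. u extreme_point_of zonotope V}"
  then have "{u} face_of zonotope V" by (simp add: face_of_singleton)
  then obtain g where g: "g \<in> span V" "{u} = zonotope V \<inter> {y. g \<bullet> y = g \<bullet> \<Sum>(positives V g)}"
    using zonotope_face_exposed[OF V(1)] by blast
  then have u: "{u} = (+) (\<Sum>(positives V g)) ` zonotope {v \<in> V. g \<bullet> v = 0}"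
    using zonotope_face[OF V(1)] by simp
  have V0: "finite {v \<in> V. g \<bullet> v = 0}" using V by simp
  have z0: "0 \<in> zonotope {v \<in> V. g \<bullet> v = 0}" using subset_sum_in_zonotope[OF V0, of "{}"] by simp
  have "\<Sum>(positives V g) + 0 \<in> {u}" unfolding u using z0 by (rule imageI)
  then have base: "u = \<Sum>(positives V g)" by simp
  have "generic V g"
  proof (rule ccontr)
    assume "\<not> generic V g"
    then obtain v where v: "v \<in> V" "g \<bullet> v = 0" by (auto simp: generic_def)
    then have "v \<in> zonotope {v \<in> V. g \<bullet> v = 0}" using subset_sum_in_zonotope[OF V0, of "{v}"] by simp
    then have "\<Sum>(positives V g) + v \<in> {u}" unfolding u by (rule imageI)
    then show False using base v V by auto
  qed
  with g(1) have "positives V g \<in> topes (span V) V" by (rule topesI)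
  then show "u \<in> Sum ` topes (span V) V" unfolding base by (rule imageI)
next
  fix u assume "u \<in> Sum ` topes (span V) V"
  then obtain g where g: "generic V g" "u = \<Sum>(positives V g)" by (auto elim: topesE)
  then have V0: "{v \<in> V. g \<bullet> v = 0} = {}" by (auto simp: generic_def)
  then have "zonotope V \<inter> {y. g \<bullet> y = g \<bullet> \<Sum>(positives V g)} = {u}"
    unfolding zonotope_face[OF V(1)] V0 by (simp add: zonotope_empty g(2))
  then have "{u} face_of zonotope V" using zonotope_face_of[OF V(1), of g] by simp
  then show "u \<in> {u. u extreme_point_of zonotope V}" by (simp add: face_of_singleton)
qed

section \<open>Parallelogram faces and coplanar generators\<close>

lemma independent_pair_not_in_span:
  assumes "independent {x, y}" "x \<noteq> y"
  shows "x \<notin> span {y}"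
  using assms by (auto simp: independent_insert)

lemma span_singleton_trans:
  fixes x y a :: "'a::real_vector"
  assumes "x \<in> span {a}" "y \<in> span {a}" "y \<noteq> 0"
  shows "x \<in> span {y}"
proof -
  obtain k m where km: "x = k *\<^sub>R a" "y = m *\<^sub>R a" using assms by (auto simp: span_singleton)
  then have "x = (k / m) *\<^sub>R y" using assms(3) by auto
  then show ?thesis by (auto simp: span_singleton)
qed

text \<open>A parallelogram lies in a translate of \<open>zonotope {a, b}\<close>. A functional that
  vanishes neither on \<open>a\<close> nor on \<open>b\<close> has a unique maximum there, while
  \<open>y\<close> and \<open>y + u\<close> are both maximal.\<close>

lemma parallelogram_edge_direction:
  fixes a b p e u :: "'a::euclidean_space"
  assumes ab: "a \<noteq> b" and F: "F = convex hull {p, p + a, p + b, p + a + b}"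
    and y: "y \<in> F" "y + u \<in> F" "u \<noteq> 0" "e \<bullet> u = 0"
    and max: "\<And>z. z \<in> F \<Longrightarrow> e \<bullet> z \<le> e \<bullet> y"
  shows "e \<bullet> a = 0 \<or> e \<bullet> b = 0"
proof (rule ccontr)
  assume "\<not> ?thesis"
  then have V0: "{v \<in> {a, b}. e \<bullet> v = 0} = {}" by auto
  let ?P = "positives {a, b} e"
  have fin: "finite {a, b}" by simp
  have sums: "\<Sum>A \<in> {0, a, b, a + b}" if "A \<subseteq> {a, b}" for A
  proof -
    have "A \<in> Pow {a, b}" using that by simp
    also have "Pow {a, b} = {{}, {a}, {b}, {a, b}}" by auto
    finally show ?thesis using ab by auto
  qed
  have "F \<subseteq> (+) p ` zonotope {a, b}"
    unfolding F
  proof (rule hull_minimal)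
    have "0 \<in> zonotope {a, b}" "a \<in> zonotope {a, b}" "b \<in> zonotope {a, b}" "a + b \<in> zonotope {a, b}"
      using subset_sum_in_zonotope[OF fin, of "{}"] subset_sum_in_zonotope[OF fin, of "{a}"]
        subset_sum_in_zonotope[OF fin, of "{b}"] subset_sum_in_zonotope[OF fin, of "{a, b}"] ab by simp_all
    then show "{p, p + a, p + b, p + a + b} \<subseteq> (+) p ` zonotope {a, b}"
      by (auto simp: add.assoc intro: image_eqI[of _ _ 0])
    show "convex ((+) p ` zonotope {a, b})"
      using polytope_imp_convex[OF polytope_zonotope[OF fin]] by (rule convex_translation)
  qed
  then have in_zonotope: "z - p \<in> zonotope {a, b}" if "z \<in> F" for z using that by auto
  have "\<Sum>?P \<in> {0, a, b, a + b}" by (rule sums) (auto simp: positives_def)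
  then have "p + \<Sum>?P \<in> {p, p + a, p + b, p + a + b}" by (auto simp: add.assoc)
  then have "p + \<Sum>?P \<in> F" unfolding F by (rule hull_inc)
  then have "e \<bullet> (p + \<Sum>?P) \<le> e \<bullet> y" by (rule max)
  then have top: "e \<bullet> \<Sum>?P \<le> e \<bullet> (z - p)" if "z = y \<or> z = y + u" for z
    using that y(4) by (auto simp: inner_add_right inner_diff_right)
  have "z - p = \<Sum>?P" if "z = y \<or> z = y + u" for z
  proof -
    have "z - p \<in> zonotope {a, b}" using that y in_zonotope by blast
    with top[OF that] zonotope_inner_le[OF fin this, of e]
    have "z - p \<in> zonotope {a, b} \<inter> {y. e \<bullet> y = e \<bullet> \<Sum>?P}" by simp
    then show ?thesis unfolding zonotope_face[OF fin] V0 by (simp add: zonotope_empty)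
  qed
  from this[of y] this[of "y + u"] have "y + u - p = y - p" by simp
  then show False using y(3) by (simp add: algebra_simps)
qed

lemma orthogonal_in_plane:
  fixes S :: "'a::euclidean_space set"
  assumes S: "subspace S" "dim S = 2" and e: "e \<in> S" "e \<noteq> 0"
    and u: "u \<in> S" "e \<bullet> u = 0" and a: "a \<in> S" "e \<bullet> a = 0" "a \<noteq> 0"
  shows "u \<in> span {a}"
proof -
  let ?O = "{y \<in> S. \<forall>x\<in>span {e}. orthogonal x y}"
  have O: "y \<in> ?O \<longleftrightarrow> y \<in> S \<and> e \<bullet> y = 0" for y
    using e by (auto simp: orthogonal_def span_singleton)
  have "subspace ?O"
    using S by (auto simp: subspace_def orthogonal_def inner_add_right)
  moreover have "dim ?O + dim (span {e}) = dim S"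
    by (rule dim_subspace_orthogonal_to_vectors) (use S e in \<open>auto intro: span_minimal[THEN subsetD]\<close>)
  then have "dim ?O = 1" using S e by (simp add: dim_insert)
  moreover have "span {a} \<subseteq> ?O"
    by (rule span_minimal) (use O a \<open>subspace ?O\<close> in auto)
  moreover have "dim (span {a}) = 1" using a by (simp add: dim_insert)
  ultimately have "span {a} = ?O" by (intro subspace_dim_equal) auto
  then show ?thesis using O u by blast
qed

text \<open>If the plane spanned by \<open>v\<close> and \<open>w\<close> contains \<open>w'\<close>, the 2-face parallel to that plane has
  edges in three directions, while a parallelogram has only two.\<close>

lemma parallelogramic_no_three_coplanar:
  fixes V :: "'a::euclidean_space set"
  assumes V: "finite V" "parallelogramic V" and v: "v \<in> V" "w \<in> V" "w' \<in> V" "v \<noteq> w" "v \<noteq> w'" "w \<noteq> w'"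
    and nz: "\<alpha> \<noteq> 0 \<or> \<beta> \<noteq> 0"
  shows "\<alpha> *\<^sub>R w + \<beta> *\<^sub>R w' \<notin> span {v}"
proof
  assume "\<alpha> *\<^sub>R w + \<beta> *\<^sub>R w' \<in> span {v}"
  then obtain \<gamma> where \<gamma>: "\<alpha> *\<^sub>R w + \<beta> *\<^sub>R w' = \<gamma> *\<^sub>R v" by (auto simp: span_singleton)
  have ind: "x \<notin> span {y}" "independent {x, y}" if "x \<in> V" "y \<in> V" "x \<noteq> y" for x y
    using V(2) that independent_pair_not_in_span[of x y]
    unfolding parallelogramic_def pairwise_def by blast+
  have nonzero: "x \<noteq> 0" if "x \<in> V" for x using V(2) that by (auto simp: parallelogramic_def)
  have "\<beta> \<noteq> 0"
  proof
    assume \<beta>: "\<beta> = 0"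
    then have "w = (\<gamma> / \<alpha>) *\<^sub>R v" using \<gamma> nz by (simp add: eq_vector_fraction_iff)
    then show False using ind(1)[of w v] v by (auto simp: span_singleton)
  qed
  define S where "S = span {v, w}"
  have S: "subspace S" "v \<in> S" "w \<in> S" by (auto simp: S_def span_base)
  have "\<beta> *\<^sub>R w' = \<gamma> *\<^sub>R v - \<alpha> *\<^sub>R w" using \<gamma> by (simp add: algebra_simps)
  then have "\<beta> *\<^sub>R w' \<in> S" using S by (simp add: subspace_diff subspace_scale)
  then have "(1 / \<beta>) *\<^sub>R \<beta> *\<^sub>R w' \<in> S" using S(1) by (rule subspace_scale[rotated])
  then have "w' \<in> S" using \<open>\<beta> \<noteq> 0\<close> by simp
  have dimS: "dim S = 2"
    using dim_eq_card_independent[OF ind(2)[of v w]] v by (simp add: S_def)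
  \<comment> \<open>A functional orthogonal to \<open>S\<close>, but to no vector of
    \<open>V\<close> outside \<open>S\<close>, exposes a 2-face parallel to
    \<open>S\<close>.\<close>
  let ?O = "{x \<in> UNIV. \<forall>y\<in>S. orthogonal y x}"
  have O: "subspace ?O" using subspace_orthogonal_to_vectors[of S] by simp
  have off: "\<exists>l\<in>?O. l \<bullet> n \<noteq> 0" if "n \<in> V - S" for n
  proof -
    obtain p z where p: "p \<in> span S" "\<And>x. x \<in> span S \<Longrightarrow> orthogonal z x" "n = p + z"
      using orthogonal_subspace_decomp_exists by blast
    have "p \<in> S" using p(1) span_minimal[OF subset_refl S(1)] by blast
    then have "z \<noteq> 0" using that p(3) by auto
    moreover have "z \<bullet> p = 0" using p(2)[OF p(1)] by (simp add: orthogonal_def)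
    ultimately have "z \<bullet> n \<noteq> 0" by (simp add: p(3) inner_add_right)
    moreover have "z \<in> ?O" using p(2) by (auto simp: orthogonal_commute span_base)
    ultimately show ?thesis by blast
  qed
  have "finite (V - S)" "(0::'a) \<in> ?O" using V(1) by (auto simp: orthogonal_def)
  from exists_generic_perturbation[OF finite.emptyI this(1) O this(2) off]
  obtain g where g: "g \<in> ?O" "generic (V - S) g" by blast
  define V0 where "V0 = V \<inter> S"
  have gS: "g \<bullet> x = 0" if "x \<in> S" for x using g(1) that by (auto simp: orthogonal_def inner_commute)
  then have V0: "{x \<in> V. g \<bullet> x = 0} = V0" using g(2) by (auto simp: V0_def generic_def)
  have fV0: "finite V0" using V(1) by (simp add: V0_def)
  have vV0: "v \<in> V0" "w \<in> V0" "w' \<in> V0" using v S \<open>w' \<in> S\<close> by (auto simp: V0_def)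
  have spanV0: "span V0 = S"
  proof
    show "span V0 \<subseteq> S" using S(1) by (intro span_minimal) (auto simp: V0_def)
    show "S \<subseteq> span V0" unfolding S_def using vV0 by (intro span_mono) auto
  qed
  let ?s = "\<Sum>(positives V g)"
  define F where "F = (+) ?s ` zonotope V0"
  have "F face_of zonotope V"
    using zonotope_face_of[OF V(1), of g] unfolding zonotope_face[OF V(1)] V0 F_def .
  moreover have "aff_dim F = 2"
    unfolding F_def using aff_dim_zonotope[OF fV0] dimS by (simp add: aff_dim_translation_eq spanV0)
  ultimately have "parallelogram F" using V(2) by (auto simp: parallelogramic_def)
  then obtain p a b where ab: "a \<noteq> b" "independent {a, b}" and F: "F = convex hull {p, p + a, p + b, p + a + b}"
    unfolding parallelogram_def by blast
  have ab0: "a \<noteq> 0" "b \<noteq> 0" using ab(2) dependent_zero[of "{a, b}"] by auto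
  have FS: "x - ?s \<in> S" if "x \<in> F" for x
    using that zonotope_subset_span[OF fV0] spanV0 by (auto simp: F_def)
  have "p \<in> F" "p + a \<in> F" "p + b \<in> F" unfolding F by (auto intro: hull_inc)
  from FS[OF this(1)] FS[OF this(2)] FS[OF this(3)] subspace_diff[OF S(1)]
  have "(p + a - ?s) - (p - ?s) \<in> S" "(p + b - ?s) - (p - ?s) \<in> S" by blast+
  then have abS: "a \<in> S" "b \<in> S" by simp_all
  \<comment> \<open>Choose \<open>e\<close> in the plane \<open>S\<close> orthogonal to
    \<open>u\<close>. The part of \<open>F\<close> where \<open>e\<close> is maximal contains a
    translate of the segment from 0 to \<open>u\<close>, so \<open>e\<close> is orthogonal to
    \<open>a\<close> or \<open>b\<close>, and this fixes the line of \<open>u\<close>.\<close>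
  have key: "u \<in> span {a} \<or> u \<in> span {b}" if u: "u \<in> V0" for u
  proof -
    have u': "u \<in> S" "u \<noteq> 0" using u nonzero by (auto simp: V0_def)
    have "card {u} < dim S" using dimS by simp
    then obtain e where e: "e \<in> S" "e \<noteq> 0" "e \<bullet> u = 0"
      using exists_orthogonal_in_subspace[OF S(1), of "{u}"] by (metis finite.emptyI finite.insertI singletonI)
    let ?P = "positives V0 e"
    have P: "?P \<subseteq> V0" "u \<notin> ?P" "finite ?P" using e fV0 by (auto simp: positives_def)
    have "\<Sum>?P \<in> zonotope V0" "\<Sum>(insert u ?P) \<in> zonotope V0"
      using P u by (intro subset_sum_in_zonotope[OF fV0]; simp)+
    then have "?s + \<Sum>?P \<in> F" "?s + \<Sum>(insert u ?P) \<in> F" unfolding F_def by blast+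
    moreover have "?s + \<Sum>(insert u ?P) = ?s + \<Sum>?P + u" using P by (simp add: algebra_simps)
    ultimately have y: "?s + \<Sum>?P \<in> F" "?s + \<Sum>?P + u \<in> F" by simp_all
    have "e \<bullet> z \<le> e \<bullet> (?s + \<Sum>?P)" if "z \<in> F" for z
      using that zonotope_inner_le[OF fV0, of _ e] by (auto simp: F_def inner_add_right)
    from parallelogram_edge_direction[OF ab(1) F y u'(2) e(3) this]
    have "e \<bullet> a = 0 \<or> e \<bullet> b = 0" by blast
    then show ?thesis
      using orthogonal_in_plane[OF S(1) dimS e(1,2) u'(1) e(3)] abS ab0 by blast
  qed
  have no: "\<not> (x \<in> span {c} \<and> y \<in> span {c})" if "x \<in> V" "y \<in> V" "x \<noteq> y" for x y c
    using span_singleton_trans[of x c y] nonzero[OF that(2)] ind(1)[OF that] by blast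
  \<comment> \<open>Of three vectors on the two lines of \<open>a\<close> and \<open>b\<close>, two
    are parallel.\<close>
  show False
    using key[OF vV0(1)] key[OF vV0(2)] key[OF vV0(3)] no[of v w] no[of v w'] no[of w w'] v by blast
qed

subsection \<open>Deformations\<close>

text \<open>Take for \<open>h\<close> the component of \<open>x - y0\<close> orthogonal to the
  directions of \<open>H\<close>, and for \<open>\<kappa>\<close> its squared length.\<close>

lemma affine_constant_gap:
  fixes H :: "'a::euclidean_space set"
  assumes H: "affine H" "y0 \<in> H" and x: "x \<notin> H"
  obtains h \<kappa> where "\<kappa> > 0" "\<And>y. y \<in> H \<Longrightarrow> h \<bullet> (x - y) = \<kappa>"
proof -
  let ?D = "(\<lambda>y. - y0 + y) ` H"
  have D: "subspace ?D" by (rule affine_diffs_subspace[OF H])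
  obtain p h where p: "p \<in> span ?D" "\<And>d. d \<in> span ?D \<Longrightarrow> orthogonal h d" "x - y0 = p + h"
    using orthogonal_subspace_decomp_exists by blast
  have "p \<in> ?D" using p(1) span_minimal[OF subset_refl D] by blast
  have "h \<noteq> 0"
  proof
    assume "h = 0"
    then have "x - y0 \<in> ?D" using \<open>p \<in> ?D\<close> p(3) by simp
    then show False using x by auto
  qed
  have "h \<bullet> (x - y) = h \<bullet> h" if "y \<in> H" for y
  proof -
    have "- y0 + y \<in> span ?D" using that by (intro span_base imageI)
    then have "h \<bullet> (- y0 + y) = 0" using p(2) by (simp add: orthogonal_def)
    moreover have "h \<bullet> (x - y0) = h \<bullet> h" using p(2)[OF p(1)] by (simp add: p(3) orthogonal_def inner_add_right)
    ultimately show ?thesis by (simp add: inner_diff_right inner_add_right)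
  qed
  then show thesis using \<open>h \<noteq> 0\<close> by (intro that[of "h \<bullet> h" h]) auto
qed

text \<open>Each dilated point splits as \<open>c *\<^sub>R u = q u + r u\<close> with
  \<open>r u\<close> in the other summand. If \<open>u\<close> maximizes \<open>f\<close>, replacing
  \<open>q u\<close> by another point of \<open>Q\<close> while keeping \<open>r u\<close> stays in
  the dilated polytope, so it cannot raise \<open>f\<close>. A point of \<open>Q\<close> outside the
  hull of the \<open>q u\<close> would be separated from it by a functional, contradicting
  this.\<close>

lemma deformation_vertex_map:
  fixes U Q :: "'a::euclidean_space set"
  assumes U: "finite U" "U \<noteq> {}" and Q: "deformation_of Q (convex hull U)"
  obtains q where "Q = convex hull (q ` U)"
    "\<And>f u y. \<lbrakk>u \<in> U; \<And>u'. u' \<in> U \<Longrightarrow> f \<bullet> u' \<le> f \<bullet> u; y \<in> Q\<rbrakk> \<Longrightarrow> f \<bullet> y \<le> f \<bullet> q u"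
proof -
  obtain c R where c: "c > 0" and eq: "(\<lambda>x. c *\<^sub>R x) ` (convex hull U) = Q + R" and poly: "polytope Q"
    using Q unfolding deformation_of_def by blast
  have "\<forall>u\<in>U. \<exists>q r. q \<in> Q \<and> r \<in> R \<and> c *\<^sub>R u = q + r"
  proof
    fix u assume "u \<in> U"
    then have "c *\<^sub>R u \<in> Q + R" unfolding eq[symmetric] by (intro imageI hull_inc)
    then show "\<exists>q r. q \<in> Q \<and> r \<in> R \<and> c *\<^sub>R u = q + r" unfolding set_plus_def by blast
  qed
  then obtain q r where qr: "\<And>u. u \<in> U \<Longrightarrow> q u \<in> Q \<and> r u \<in> R \<and> c *\<^sub>R u = q u + r u" by metis
  have max: "f \<bullet> y \<le> f \<bullet> q u" if u: "u \<in> U" "\<And>u'. u' \<in> U \<Longrightarrow> f \<bullet> u' \<le> f \<bullet> u" and y: "y \<in> Q" for f u y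
  proof -
    have "y + r u \<in> (\<lambda>x. c *\<^sub>R x) ` (convex hull U)" unfolding eq using y qr[OF u(1)] by (auto intro: set_plus_intro)
    then obtain x where x: "x \<in> convex hull U" "y + r u = c *\<^sub>R x" by blast
    have "convex hull U \<subseteq> {x. f \<bullet> x \<le> f \<bullet> u}"
      by (rule hull_minimal) (use u(2) in \<open>auto simp: convex_halfspace_le\<close>)
    then have "c * (f \<bullet> x) \<le> c * (f \<bullet> u)" using x(1) c by auto
    moreover have "f \<bullet> y + f \<bullet> r u = c * (f \<bullet> x)" using x(2) by (metis inner_add_right inner_scaleR_right)
    moreover have "f \<bullet> q u + f \<bullet> r u = c * (f \<bullet> u)" using qr[OF u(1)] by (metis inner_add_right inner_scaleR_right)
    ultimately show ?thesis by linarith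
  qed
  have "Q \<subseteq> convex hull (q ` U)"
  proof
    fix y assume y: "y \<in> Q"
    show "y \<in> convex hull (q ` U)"
    proof (rule ccontr)
      assume ny: "y \<notin> convex hull (q ` U)"
      have "closed (convex hull (q ` U))"
        using U(1) by (intro compact_imp_closed finite_imp_compact_convex_hull) auto
      then obtain a b where ab: "a \<bullet> y < b" "\<forall>x\<in>convex hull (q ` U). b < a \<bullet> x"
        using separating_hyperplane_closed_point[OF convex_convex_hull _ ny] by blast
      obtain u where u: "u \<in> U" "\<And>u'. u' \<in> U \<Longrightarrow> a \<bullet> u \<le> a \<bullet> u'"
        using arg_min_if_finite(1)[OF U, of "\<lambda>u. a \<bullet> u"] arg_min_least[OF U, of _ "\<lambda>u. a \<bullet> u"] by blast
      have "(- a) \<bullet> y \<le> (- a) \<bullet> q u" by (rule max[OF u(1) _ y]) (use u(2) in simp)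
      moreover have "b < a \<bullet> q u" using ab(2) u(1) by (intro bspec[OF ab(2)] hull_inc imageI)
      ultimately show False using ab(1) by simp
    qed
  qed
  moreover have "convex hull (q ` U) \<subseteq> Q"
    using qr polytope_imp_convex[OF poly] by (intro hull_minimal) auto
  ultimately show thesis using max by (intro that[of q]) auto
qed

text \<open>Any functional exposing the edge can be perturbed in all directions orthogonal to \<open>v\<close>.\<close>

lemma edge_difference_in_span:
  fixes V :: "'a::euclidean_space set"
  assumes V: "finite V" "v \<in> V" "v \<notin> A" and A: "A \<in> topes L V" "insert v A \<in> topes L V" "subspace L"
    and max: "\<And>f. (\<And>y. y \<in> zonotope V \<Longrightarrow> f \<bullet> y \<le> f \<bullet> \<Sum>A) \<Longrightarrow> f \<bullet> \<Sum>(insert v A) = f \<bullet> \<Sum>A \<Longrightarrow> f \<bullet> a = f \<bullet> b"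
  shows "b - a \<in> span {v}"
proof -
  obtain g where g: "g \<bullet> v = 0" "generic (V - {v}) g" "positives V g = A"
    using topes_wallD[OF A(3) V(2,3) A(1,2)] by metis
  have finA: "finite A" using topes_subset[OF A(1)] V(1) finite_subset by blast
  have orth: "e \<bullet> (b - a) = 0" if e: "e \<bullet> v = 0" for e
  proof -
    obtain \<epsilon> where \<epsilon>: "\<epsilon> > 0" "\<And>w t. \<lbrakk>w \<in> V; g \<bullet> w \<noteq> 0; \<bar>t\<bar> \<le> \<epsilon>\<rbrakk> \<Longrightarrow> sgn ((g + t *\<^sub>R e) \<bullet> w) = sgn (g \<bullet> w)"
      using exists_sgn_perturbation[OF V(1), of g e] by metis
    have eq: "(g + t *\<^sub>R e) \<bullet> a = (g + t *\<^sub>R e) \<bullet> b" if t: "\<bar>t\<bar> \<le> \<epsilon>" for t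
    proof (rule max)
      have fv: "(g + t *\<^sub>R e) \<bullet> v = 0" using g e by (simp add: inner_add_left)
      have "positives V (g + t *\<^sub>R e) = positives V g"
      proof (rule positives_cong)
        fix w assume w: "w \<in> V"
        show "sgn ((g + t *\<^sub>R e) \<bullet> w) = sgn (g \<bullet> w)"
        proof (cases "w = v")
          case True then show ?thesis using fv g by simp
        next
          case False then show ?thesis using \<epsilon>(2)[OF w _ t] g(2) w by (auto simp: generic_def)
        qed
      qed
      then show "(g + t *\<^sub>R e) \<bullet> y \<le> (g + t *\<^sub>R e) \<bullet> \<Sum>A" if "y \<in> zonotope V" for y
        using zonotope_inner_le[OF V(1) that, of "g + t *\<^sub>R e"] g(3) by simp
      show "(g + t *\<^sub>R e) \<bullet> \<Sum>(insert v A) = (g + t *\<^sub>R e) \<bullet> \<Sum>A"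
        using fv V(3) finA by (simp add: inner_add_right)
    qed
    \<comment> \<open>Both perturbed functionals expose the same edge; their difference isolates the
      value of \<open>e\<close> on \<open>b - a\<close>.\<close>
    have "(g + \<epsilon> *\<^sub>R e) \<bullet> (b - a) = 0" "(g + (- \<epsilon>) *\<^sub>R e) \<bullet> (b - a) = 0"
      using eq[of \<epsilon>] eq[of "- \<epsilon>"] \<epsilon>(1) by (simp_all add: inner_diff_right)
    then have "\<epsilon> * (e \<bullet> (b - a)) = 0" unfolding inner_add_left inner_scaleR_left by argo
    then show ?thesis using \<epsilon>(1) by simp
  qed
  \<comment> \<open>Applied to the component of \<open>b - a\<close> orthogonal to \<open>v\<close>,
    \<open>orth\<close> makes that component orthogonal to itself.\<close>
  obtain p z where p: "p \<in> span {v}" "\<And>x. x \<in> span {v} \<Longrightarrow> orthogonal z x" "b - a = p + z"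
    using orthogonal_subspace_decomp_exists by blast
  have "z \<bullet> v = 0" "z \<bullet> p = 0" using p(1) p(2)[of p] p(2)[of v] by (auto simp: orthogonal_def span_base)
  with orth[of z] p(3) have "z = 0" by (simp add: inner_add_right)
  then show ?thesis using p by simp
qed

section \<open>Edge directions and their scaling factors\<close>

lemma exists_orthogonal_detecting:
  fixes v z :: "'a::euclidean_space"
  assumes "z \<notin> span {v}" "z \<in> S" "v \<in> S" "subspace S"
  obtains l where "l \<in> S" "l \<bullet> v = 0" "l \<bullet> z \<noteq> 0"
proof -
  obtain p l where p: "p \<in> span {v}" "\<And>x. x \<in> span {v} \<Longrightarrow> orthogonal l x" "z = p + l"
    using orthogonal_subspace_decomp_exists by blast
  have "p \<in> S" using p(1) span_minimal[of "{v}" S] assms(3,4) by auto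
  moreover have "l = z - p" using p(3) by simp
  ultimately have "l \<in> S" using assms(2,4) by (simp add: subspace_diff)
  moreover have "l \<bullet> v = 0" "l \<bullet> p = 0" using p(1) p(2)[of p] p(2)[of v] by (auto simp: orthogonal_def span_base)
  moreover have "l \<noteq> 0" using p assms(1) by auto
  ultimately show thesis using p(3) by (intro that[of l]) (auto simp: inner_add_right)
qed

text \<open>The functional exposing the edge at \<open>x\<close> can vanish on no generator except
  \<open>v\<close>, since any other would put a segment not parallel to \<open>v\<close> into the
  edge. So the two ends of the edge, both maximal, agree outside \<open>v\<close> and differ at
  \<open>v\<close>.\<close>

lemma tope_neighbour:
  fixes V :: "'a::euclidean_space set"
  assumes V: "finite V" "parallelogramic V" and v: "v \<in> V"
    and x: "x = \<Sum>A" "A \<in> topes (span V) V" and inc: "incident_around V v x"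
  defines "N \<equiv> if v \<in> A then A - {v} else insert v A"
  shows "N \<in> topes (span V) V" "adjacent (zonotope V) x (\<Sum>N)"
proof -
  have V0: "0 \<notin> V" using V(2) by (simp add: parallelogramic_def)
  obtain w where w: "adjacent (zonotope V) x w" "closed_segment x w \<in> edge_class V v"
    using inc unfolding incident_around_def by blast
  obtain a b where ab: "closed_segment x w = closed_segment a b" "b - a \<in> span {v}"
    using w(2) unfolding edge_class_def by blast
  have edge: "closed_segment x w face_of zonotope V" "aff_dim (closed_segment x w) = 1"
    using w(1) unfolding adjacent_def edge_of_def by auto
  have "x \<noteq> w" using edge(2) by auto
  have par: "y - z \<in> span {v}" if "y \<in> closed_segment x w" "z \<in> closed_segment x w" for y z
  proof -
    obtain s t where st: "y = (1 - s) *\<^sub>R a + s *\<^sub>R b" "z = (1 - t) *\<^sub>R a + t *\<^sub>R b"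
      using \<open>y \<in> _\<close> \<open>z \<in> _\<close> unfolding ab(1) by (auto simp: in_segment)
    have "y - z = (s - t) *\<^sub>R (b - a)" unfolding st by (simp add: algebra_simps)
    then show ?thesis using ab(2) by (simp add: span_scale)
  qed
  have "w extreme_point_of zonotope V"
    using extreme_point_of_face[OF edge(1), of w] extreme_point_of_segment[of w x w] by simp
  then obtain B where B: "w = \<Sum>B" "B \<in> topes (span V) V"
    using zonotope_extreme_points[OF V(1) V0] by blast
  obtain g where g: "closed_segment x w = zonotope V \<inter> {y. g \<bullet> y = g \<bullet> \<Sum>(positives V g)}"
    using zonotope_face_exposed[OF V(1) edge(1)] by (metis empty_iff ends_in_segment(1))
  have sub: "A \<subseteq> V" "B \<subseteq> V" using x(2) B(2) topes_subset by blast+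
  have only: "u = v" if u: "u \<in> V" "g \<bullet> u = 0" for u
  proof (rule ccontr)
    assume "u \<noteq> v"
    have P: "finite (positives V g)" "positives V g \<subseteq> V" "u \<notin> positives V g"
      using V(1) u by (auto simp: positives_def)
    have "\<Sum>(positives V g) \<in> closed_segment x w" "\<Sum>(insert u (positives V g)) \<in> closed_segment x w"
      unfolding g using P u subset_sum_in_zonotope[OF V(1)] by (auto simp: inner_add_right simp del: sum.insert) (simp add: inner_add_right)
    from par[OF this(2,1)] have "u \<in> span {v}" using P by simp
    moreover have "independent {u, v}" using V(2) u v \<open>u \<noteq> v\<close> by (auto simp: parallelogramic_def pairwise_def)
    ultimately show False using independent_pair_not_in_span[of u v] \<open>u \<noteq> v\<close> by blast
  qed
  have "x \<in> closed_segment x w" "w \<in> closed_segment x w" by simp_all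
  then have top: "g \<bullet> \<Sum>(positives V g) \<le> g \<bullet> \<Sum>A" "g \<bullet> \<Sum>(positives V g) \<le> g \<bullet> \<Sum>B"
    unfolding g using x(1) B(1) by auto
  have agree: "u \<in> A \<longleftrightarrow> u \<in> B" if "u \<noteq> v" for u
  proof (cases "u \<in> V")
    case True
    then show ?thesis
      using subset_sum_maximal[OF V(1) sub(1) top(1) True] subset_sum_maximal[OF V(1) sub(2) top(2) True]
        only[OF True] that by blast
  qed (use sub in blast)
  have "A \<noteq> B" using \<open>x \<noteq> w\<close> x(1) B(1) by blast
  then have "v \<in> A \<longleftrightarrow> v \<notin> B" using agree set_eqI[of A B] by metis
  have "u \<in> N \<longleftrightarrow> u \<in> B" for u
    by (cases "u = v") (use agree[of u] \<open>v \<in> A \<longleftrightarrow> v \<notin> B\<close> in \<open>simp_all add: N_def\<close>)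
  then have "N = B" by blast
  then show "N \<in> topes (span V) V" "adjacent (zonotope V) x (\<Sum>N)" using B w(1) by simp_all
qed

text \<open>The edges in direction \<open>v\<close> that avoid \<open>X\<close> are topes in the
  hyperplane orthogonal to \<open>v\<close>, with no more than \<open>card X\<close> of them
  removed. Adjacent ones are opposite sides of a parallelogram whose four vertices survive, so they
  have the same factor, and connectivity in dimension \<open>dim (span V) - 1\<close> carries it to
  all.\<close>

lemma edge_class_ratio:
  fixes V :: "'a::euclidean_space set"
  assumes V: "finite V" "parallelogramic V" and v: "v \<in> V"
    and X: "X \<subseteq> topes (span V) V" "card X + 1 < dim (span V)"
    and edge: "\<And>A w. \<lbrakk>w \<in> V; w \<notin> A; A \<in> topes (span V) V - X; insert w A \<in> topes (span V) V - X\<rbrakk>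
                 \<Longrightarrow> q (insert w A) - q A \<in> span {w}"
  shows "\<exists>\<rho>. \<forall>A. v \<notin> A \<longrightarrow> A \<in> topes (span V) V - X \<longrightarrow> insert v A \<in> topes (span V) V - X \<longrightarrow>
           q (insert v A) - q A = \<rho> *\<^sub>R v"
proof -
  let ?T = "topes (span V) V"
  let ?L = "{g \<in> span V. g \<bullet> v = 0}"
  let ?W = "V - {v}"
  have v0: "v \<noteq> 0" "v \<in> span V" using V(2) v by (auto simp: parallelogramic_def span_base)
  note wall_iff = topes_wall_iff[OF subspace_span V(1) v v0(2,1)]
  have finX: "finite X"
    by (rule finite_subset[of _ "Pow V"]) (use topes_subset[OF subsetD[OF X(1)]] V(1) in auto)
  define B where "B = {A \<in> topes ?L ?W. A \<in> X \<or> insert v A \<in> X}"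
  define \<Phi> where "\<Phi> A = (SOME k. q (insert v A) - q A = k *\<^sub>R v)" for A
  have good: "A \<in> topes ?L ?W - B \<longleftrightarrow> v \<notin> A \<and> A \<in> ?T - X \<and> insert v A \<in> ?T - X" for A
    unfolding B_def using wall_iff[of A] by blast
  have \<Phi>: "q (insert v A) - q A = \<Phi> A *\<^sub>R v" if "A \<in> topes ?L ?W - B" for A
  proof -
    have "\<exists>k. q (insert v A) - q A = k *\<^sub>R v"
      using edge[of v A] that v unfolding good by (auto simp: span_singleton)
    then show ?thesis unfolding \<Phi>_def by (rule someI_ex)
  qed
  have const: "\<Phi> A = \<Phi> A'" if "A \<in> topes ?L ?W - B" "A' \<in> topes ?L ?W - B" for A A'
  proof (rule topes_connected[OF _ _ _ _ _ _ _ that])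
    show "finite ?W" using V(1) by simp
    show L: "subspace ?L" by (auto simp: subspace_def inner_add_left span_add span_scale span_zero)
    show "\<exists>l\<in>?L. l \<bullet> (\<alpha> *\<^sub>R w + \<beta> *\<^sub>R w') \<noteq> 0"
      if "w \<in> ?W" "w' \<in> ?W" "w \<noteq> w'" "\<alpha> \<noteq> 0 \<or> \<beta> \<noteq> 0" for w w' and \<alpha> \<beta> :: real
    proof -
      \<comment> \<open>Independence of \<open>w\<close> and \<open>w'\<close> survives the
        projection along \<open>v\<close> because no three generators are coplanar.\<close>
      have n: "\<alpha> *\<^sub>R w + \<beta> *\<^sub>R w' \<notin> span {v}"
        using that v by (intro parallelogramic_no_three_coplanar[OF V]) auto
      have m: "\<alpha> *\<^sub>R w + \<beta> *\<^sub>R w' \<in> span V"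
        using that by (intro span_add span_scale span_base) auto
      show ?thesis
        using exists_orthogonal_detecting[OF n m v0(2) subspace_span] by blast
    qed
    show "\<exists>w\<in>?W. f \<bullet> w \<noteq> 0" if f: "f \<in> ?L" "f \<noteq> 0" for f
    proof (rule ccontr)
      assume "\<not> ?thesis"
      then have "orthogonal f w" if "w \<in> V" for w using f that by (cases "w = v") (auto simp: orthogonal_def)
      then have "orthogonal f f" using f by (intro orthogonal_to_span[of f V f]) auto
      then show False using f by (simp add: orthogonal_def)
    qed
    \<comment> \<open>A removed vertex lies on no more than one edge in direction \<open>v\<close>,
      so passing from vertices to edges does not increase the number of removed objects.\<close>
    have BX: "B \<subseteq> (\<lambda>C. C - {v}) ` X"
    proof
      fix A assume A: "A \<in> B"
      then have vA: "v \<notin> A" unfolding B_def using wall_iff[of A] by blast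
      then have "A = A - {v}" "A = insert v A - {v}" by auto
      then show "A \<in> (\<lambda>C. C - {v}) ` X" using A unfolding B_def by blast
    qed
    then show "finite B" using finX finite_surj by blast
    have "card B \<le> card X" using BX finX by (rule surj_card_le[rotated])
    moreover have "dim ?L + 1 = dim (span V)"
    proof -
      have "dim {y \<in> span V. \<forall>x\<in>span {v}. orthogonal x y} + dim (span {v}) = dim (span V)"
        by (rule dim_subspace_orthogonal_to_vectors) (use v in \<open>auto intro: span_mono[THEN subsetD]\<close>)
      moreover have "{y \<in> span V. \<forall>x\<in>span {v}. orthogonal x y} = ?L"
        by (auto simp: orthogonal_def span_singleton inner_commute)
      ultimately show ?thesis using v0 by (simp add: dim_insert)
    qed
    ultimately show "card B < dim ?L" using X(2) by linarith
    show "\<Phi> A = \<Phi> (insert w A)"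
      if w: "w \<in> ?W" "w \<notin> A" and A: "A \<in> topes ?L ?W - B" "insert w A \<in> topes ?L ?W - B" for w A
    proof -
      have com: "insert v (insert w A) = insert w (insert v A)" by blast
      have A': "v \<notin> A" "A \<in> ?T - X" "insert v A \<in> ?T - X" "insert w A \<in> ?T - X" "insert w (insert v A) \<in> ?T - X"
        using A unfolding good com by blast+
      have wV: "w \<in> V" "w \<noteq> v" using w by auto
      obtain m1 where m1: "q (insert w A) - q A = m1 *\<^sub>R w"
        using edge[of w A] A' w wV by (auto simp: span_singleton)
      obtain m2 where m2: "q (insert w (insert v A)) - q (insert v A) = m2 *\<^sub>R w"
        using edge[of w "insert v A"] A' w wV by (auto simp: span_singleton)
      have k2: "q (insert w (insert v A)) - q (insert w A) = \<Phi> (insert w A) *\<^sub>R v"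
        using \<Phi>[OF A(2)] unfolding com .
      \<comment> \<open>The four edges of the parallelogram close up, so the difference of the two
        factors times \<open>v\<close> is a multiple of \<open>w\<close>; independence makes that
        difference 0.\<close>
      have "(\<Phi> A - \<Phi> (insert w A)) *\<^sub>R v = (m1 - m2) *\<^sub>R w"
        unfolding scaleR_diff_left m1[symmetric] m2[symmetric] k2[symmetric] \<Phi>[OF A(1), symmetric] by simp
      then have "v = ((m1 - m2) / (\<Phi> A - \<Phi> (insert w A))) *\<^sub>R w" if "\<Phi> A \<noteq> \<Phi> (insert w A)"
        using that by (simp add: eq_vector_fraction_iff)
      then have "v \<in> span {w}" if "\<Phi> A \<noteq> \<Phi> (insert w A)" using that by (metis rangeI span_singleton)
      moreover have "v \<notin> span {w}"
        using V(2) v wV by (intro independent_pair_not_in_span) (auto simp: parallelogramic_def pairwise_def)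
      ultimately show ?thesis by blast
    qed
  qed
  show ?thesis
  proof (cases "topes ?L ?W - B = {}")
    case True
    then show ?thesis using good by blast
  next
    case False
    then obtain A0 where A0: "A0 \<in> topes ?L ?W - B" by blast
    have "q (insert v A) - q A = \<Phi> A0 *\<^sub>R v" if "A \<in> topes ?L ?W - B" for A
      using \<Phi>[OF that] const[OF that A0] by simp
    then show ?thesis using good by blast
  qed
qed

text \<open>Here \<open>A0\<close> is the tope of the special vertex, \<open>N v\<close> its
  neighbour along \<open>v\<close>, and \<open>h\<close> a normal of the hyperplane through the
  neighbours. Once each direction has its own factor and \<open>q\<close> is given by these factors,
  evaluating \<open>h\<close> on the neighbours forces them to agree.\<close>

lemma vertex_map_affine:
  fixes V :: "'a::euclidean_space set"
  assumes V: "finite V" "parallelogramic V" and d: "3 \<le> dim (span V)"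
    and X: "X \<subseteq> topes (span V) V" "card X + 1 < dim (span V)"
    and A0: "A0 \<subseteq> V" and N: "\<And>v. v \<in> V \<Longrightarrow> N v = (if v \<in> A0 then A0 - {v} else insert v A0)"
    and NU: "\<And>v. v \<in> V \<Longrightarrow> N v \<in> topes (span V) V - X" and A0X: "A0 \<in> X"
    and h: "\<kappa> > 0" "\<And>v. v \<in> V \<Longrightarrow> h \<bullet> (\<Sum>A0 - \<Sum>(N v)) = \<kappa>"
    and edge: "\<And>A w. \<lbrakk>w \<in> V; w \<notin> A; A \<in> topes (span V) V - X; insert w A \<in> topes (span V) V - X\<rbrakk>
                 \<Longrightarrow> q (insert w A) - q A \<in> span {w}"
    and max: "\<And>f A B. \<lbrakk>A \<in> topes (span V) V - X; B \<in> topes (span V) V - X;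
                 \<And>C. C \<in> topes (span V) V - X \<Longrightarrow> f \<bullet> \<Sum>C \<le> f \<bullet> \<Sum>A\<rbrakk> \<Longrightarrow> f \<bullet> q B \<le> f \<bullet> q A"
  shows "\<exists>c t. 0 \<le> c \<and> (\<forall>A\<in>topes (span V) V - X. q A = t + c *\<^sub>R \<Sum>A)"
proof -
  let ?U = "topes (span V) V - X"
  have "\<forall>v\<in>V. \<exists>\<rho>. \<forall>A. v \<notin> A \<longrightarrow> A \<in> ?U \<longrightarrow> insert v A \<in> ?U \<longrightarrow> q (insert v A) - q A = \<rho> *\<^sub>R v"
    using edge_class_ratio[OF V _ X edge] by blast
  then obtain \<rho> where \<rho>: "\<And>v A. \<lbrakk>v \<in> V; v \<notin> A; A \<in> ?U; insert v A \<in> ?U\<rbrakk> \<Longrightarrow> q (insert v A) - q A = \<rho> v *\<^sub>R v"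
    by metis
  have finX: "finite X"
    by (rule finite_subset[of _ "Pow V"]) (use topes_subset[OF subsetD[OF X(1)]] V(1) in auto)
  have sub: "A \<subseteq> V" "finite A" if "A \<in> ?U" for A
    using that topes_subset[of A "span V" V] V(1) finite_subset[of A V] by auto
  have "\<not> card V < 2" using d dim_le_card'[OF V(1)] by simp
  \<comment> \<open>Crossing an edge in direction \<open>w\<close> changes \<open>q\<close> and the
    subtracted sum by the same \<open>\<rho> w *\<^sub>R w\<close>, so connectivity will make
    \<open>\<Psi>\<close> constant.\<close>
  define \<Psi> where "\<Psi> A = q A - (\<Sum>u\<in>A. \<rho> u *\<^sub>R u)" for A
  have const: "\<Psi> A = \<Psi> A'" if "A \<in> ?U" "A' \<in> ?U" for A A'
  proof (rule topes_connected[OF V(1) subspace_span _ _ finX _ _ that])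
    show "\<exists>l\<in>span V. l \<bullet> (\<alpha> *\<^sub>R w + \<beta> *\<^sub>R w') \<noteq> 0"
      if w: "w \<in> V" "w' \<in> V" "w \<noteq> w'" "\<alpha> \<noteq> 0 \<or> \<beta> \<noteq> 0" for w w' and \<alpha> \<beta> :: real
    proof -
      have "\<not> V \<subseteq> {w, w'}"
      proof
        assume "V \<subseteq> {w, w'}"
        then have "card V \<le> 2" using card_mono[of "{w, w'}" V] w(3) by simp
        then show False using d dim_le_card'[OF V(1)] by simp
      qed
      then obtain v where "v \<in> V" "v \<noteq> w" "v \<noteq> w'" by blast
      from parallelogramic_no_three_coplanar[OF V this(1) w(1,2) this(2,3) w(3,4)]
      have "\<alpha> *\<^sub>R w + \<beta> *\<^sub>R w' \<noteq> 0" by (auto simp: span_zero)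
      moreover have "\<alpha> *\<^sub>R w + \<beta> *\<^sub>R w' \<in> span V" using w by (intro span_add span_scale span_base)
      ultimately show ?thesis using inner_eq_zero_iff by blast
    qed
    show "\<exists>w\<in>V. f \<bullet> w \<noteq> 0" if f: "f \<in> span V" "f \<noteq> 0" for f
    proof (rule ccontr)
      assume "\<not> ?thesis"
      then have "orthogonal f w" if "w \<in> V" for w using that by (auto simp: orthogonal_def)
      then have "orthogonal f f" using f by (intro orthogonal_to_span[of f V f]) auto
      then show False using f by (simp add: orthogonal_def)
    qed
    show "card X < dim (span V)" using X by simp
    show "\<Psi> A = \<Psi> (insert w A)" if w: "w \<in> V" "w \<notin> A" and A: "A \<in> ?U" "insert w A \<in> ?U" for w A
    proof -
      have "q (insert w A) = q A + \<rho> w *\<^sub>R w" using \<rho>[OF w A] by (simp add: algebra_simps)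
      then show ?thesis using w(2) sub(2)[OF A(1)] by (simp add: \<Psi>_def)
    qed
  qed
  obtain v0 where v0: "v0 \<in> V" using \<open>\<not> card V < 2\<close> by fastforce
  define t where "t = \<Psi> (N v0)"
  have q: "q A = t + (\<Sum>u\<in>A. \<rho> u *\<^sub>R u)" if "A \<in> ?U" for A
    using const[OF that NU[OF v0]] unfolding t_def \<Psi>_def by (metis diff_add_cancel)
  have finA0: "finite A0" using A0 V(1) finite_subset by blast
  \<comment> \<open>Flipping the membership of any one \<open>v\<close> in \<open>A0\<close> costs
    exactly \<open>\<kappa>\<close>.\<close>
  have hv: "h \<bullet> v = (if v \<in> A0 then \<kappa> else - \<kappa>)" if v: "v \<in> V" for v
  proof (cases "v \<in> A0")
    case True
    then have "\<Sum>A0 - \<Sum>(N v) = v" using N[OF v] finA0 by (simp add: sum.remove[of A0 v])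
    then show ?thesis using h(2)[OF v] True by simp
  next
    case False
    then have "\<Sum>A0 - \<Sum>(N v) = - v" using N[OF v] finA0 by simp
    then show ?thesis using h(2)[OF v] False by simp
  qed
  have NV: "N v \<subseteq> V" if "v \<in> V" for v using N[OF that] A0 that by auto
  \<comment> \<open>Every surviving tope differs from \<open>A0\<close> in at least one vector and
    hence loses at least \<open>\<kappa>\<close>; the neighbours lose exactly that, so they all
    maximize \<open>h\<close> among the survivors.\<close>
  have top: "h \<bullet> \<Sum>C \<le> h \<bullet> \<Sum>(N v)" if v: "v \<in> V" and C: "C \<in> ?U" for v C
  proof -
    have "C \<noteq> A0" using C A0X by blast
    then obtain u where u: "u \<in> V" "u \<in> C \<longleftrightarrow> u \<notin> A0" using sub(1)[OF C] A0 by blast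
    have "h \<bullet> \<Sum>C \<le> h \<bullet> \<Sum>(N u)"
      unfolding sum_subset_inner[OF V(1) sub(1)[OF C]] sum_subset_inner[OF V(1) NV[OF u(1)]]
    proof (rule sum_mono)
      fix w assume w: "w \<in> V"
      show "(if w \<in> C then h \<bullet> w else 0) \<le> (if w \<in> N u then h \<bullet> w else 0)"
        using N[OF u(1)] u hv[OF w] h(1) by (cases "w = u") auto
    qed
    also have "\<dots> = h \<bullet> \<Sum>(N v)" using h(2)[OF u(1)] h(2)[OF v] by (simp add: inner_diff_right)
    finally show ?thesis .
  qed
  have hq: "h \<bullet> q (N v) = h \<bullet> t + (\<Sum>u\<in>A0. \<rho> u * (h \<bullet> u)) - \<rho> v * \<kappa>" if v: "v \<in> V" for v
  proof (cases "v \<in> A0")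
    case True
    then have "(\<Sum>u\<in>A0. \<rho> u * (h \<bullet> u)) = \<rho> v * (h \<bullet> v) + (\<Sum>u\<in>N v. \<rho> u * (h \<bullet> u))"
      using N[OF v] finA0 by (simp add: sum.remove[of A0 v])
    then show ?thesis
      using True unfolding q[OF NU[OF v]] by (simp add: inner_add_right inner_sum_right hv[OF v])
  next
    case False
    then have "(\<Sum>u\<in>N v. \<rho> u * (h \<bullet> u)) = \<rho> v * (h \<bullet> v) + (\<Sum>u\<in>A0. \<rho> u * (h \<bullet> u))"
      using N[OF v] finA0 by simp
    then show ?thesis
      using False unfolding q[OF NU[OF v]] by (simp add: inner_add_right inner_sum_right hv[OF v])
  qed
  have "\<rho> v = \<rho> v0" if v: "v \<in> V" for v
  proof -
    have "h \<bullet> q (N v) = h \<bullet> q (N v0)"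
      by (intro antisym max NU v v0 top)
    then show ?thesis unfolding hq[OF v] hq[OF v0] using h(1) by simp
  qed
  then have aff: "q A = t + \<rho> v0 *\<^sub>R \<Sum>A" if "A \<in> ?U" for A
    using q[OF that] sub(1)[OF that] by (auto simp: scaleR_sum_right intro!: sum.cong)
  \<comment> \<open>The sign of the common factor comes from a functional that is maximal at
    \<open>N v0\<close> and strictly smaller at another neighbour: \<open>q\<close> cannot reverse
    this order.\<close>
  have "0 \<le> \<rho> v0"
  proof -
    have "\<not> V \<subseteq> {v0}"
      using \<open>\<not> card V < 2\<close> card_mono[of "{v0}" V] by auto
    then obtain v where v: "v \<in> V" "v \<noteq> v0" by blast
    have ne: "N v0 \<noteq> N v" using N[OF v(1)] N[OF v0] v(2) by (auto split: if_splits)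
    have "N v0 \<in> topes (span V) V" using NU[OF v0] by blast
    then obtain g where g: "generic V g" "N v0 = positives V g" by (rule topesE)
    have "g \<bullet> \<Sum>(N v) < g \<bullet> \<Sum>(N v0)"
    proof (rule ccontr)
      assume "\<not> ?thesis"
      then have "g \<bullet> \<Sum>(positives V g) \<le> g \<bullet> \<Sum>(N v)" using g(2) by simp
      from subset_sum_maximal[OF V(1) NV[OF v(1)] this] have "N v = positives V g"
        using g(1) NV[OF v(1)] by (auto simp: generic_def positives_def)
      then show False using ne g(2) by simp
    qed
    moreover have "g \<bullet> q (N v) \<le> g \<bullet> q (N v0)"
    proof (rule max[OF NU[OF v0] NU[OF v(1)]])
      fix C assume "C \<in> ?U"
      then show "g \<bullet> \<Sum>C \<le> g \<bullet> \<Sum>(N v0)"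
        unfolding g(2) using subset_sum_in_zonotope[OF V(1) sub(1)] by (intro zonotope_inner_le[OF V(1)])
    qed
    then have "\<rho> v0 * (g \<bullet> \<Sum>(N v)) \<le> \<rho> v0 * (g \<bullet> \<Sum>(N v0))"
      unfolding aff[OF NU[OF v0]] aff[OF NU[OF v(1)]] by (simp add: inner_add_right)
    ultimately show ?thesis by (smt (verit) mult_less_cancel_left)
  qed
  then show ?thesis using aff by blast
qed

text \<open>The neighbours arise from \<open>\<Sum>A0\<close> by adding or subtracting one vector of
  \<open>V\<close>. Were \<open>\<Sum>A0\<close> in \<open>H\<close> as well, the directions of
  \<open>H\<close> would contain \<open>V\<close>, against the bound on \<open>aff_dim H\<close>. So
  the point is off \<open>H\<close> and \<open>affine_constant_gap\<close> applies.\<close>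

lemma truncation_functional:
  fixes V :: "'a::euclidean_space set"
  assumes V: "finite V" and d: "0 < dim (span V)" and A0: "A0 \<subseteq> V" and N: "\<And>v. v \<in> V \<Longrightarrow> N v = (if v \<in> A0 then A0 - {v} else insert v A0)"
    and H: "affine H" "aff_dim H < int (dim (span V))" "\<And>v. v \<in> V \<Longrightarrow> \<Sum>(N v) \<in> H"
  obtains h \<kappa> where "\<kappa> > 0" "\<And>v. v \<in> V \<Longrightarrow> h \<bullet> (\<Sum>A0 - \<Sum>(N v)) = \<kappa>"
proof -
  have fin: "finite A0" using A0 V finite_subset by blast
  have "\<Sum>A0 \<notin> H"
  proof
    assume x: "\<Sum>A0 \<in> H"
    let ?D = "(\<lambda>y. - \<Sum>A0 + y) ` H"
    have D: "subspace ?D" by (rule affine_diffs_subspace[OF H(1) x])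
    have "V \<subseteq> ?D"
    proof
      fix v assume v: "v \<in> V"
      have mem: "- \<Sum>A0 + \<Sum>(N v) \<in> ?D" using H(3)[OF v] by (rule imageI)
      show "v \<in> ?D"
      proof (cases "v \<in> A0")
        case True
        then have "- \<Sum>A0 + \<Sum>(N v) = - v" using N[OF v] fin by (simp add: sum.remove[of A0 v])
        then show ?thesis using mem subspace_neg[OF D, of "- v"] by simp
      next
        case False
        then have "- \<Sum>A0 + \<Sum>(N v) = v" using N[OF v] fin by simp
        then show ?thesis using mem by simp
      qed
    qed
    then have "dim (span V) \<le> dim ?D" using D by (intro dim_subset span_minimal)
    moreover have "int (dim ?D) = aff_dim H"
      using aff_dim_subspace[OF D] unfolding aff_dim_translation_eq by simp
    ultimately show False using H(2) by linarith
  qed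
  moreover obtain v where "v \<in> V" using d by fastforce
  ultimately show thesis
    using affine_constant_gap[OF H(1) H(3)] H(3) that by metis
qed

text \<open>Translates removed vertices into removed topes and feeds the map of
  \<open>deformation_vertex_map\<close> to \<open>vertex_map_affine\<close>. The first claim of the
  theorem is the case \<open>X = {x\<^sub>0}\<close>.\<close>

lemma deep_truncation_indecomposable:
  fixes V :: "'a::euclidean_space set"
  assumes V: "finite V" "parallelogramic V" and d: "aff_dim (zonotope V) \<ge> 3"
    and trunc: "admits_deep_truncation (zonotope V) x"
    and inc: "\<And>v. v \<in> V \<Longrightarrow> incident_around V v x"
    and X: "X \<subseteq> {u. u extreme_point_of zonotope V}" "x \<in> X" "int (card X) \<le> aff_dim (zonotope V) - 2"
    and nonadj: "\<And>y. y \<in> X \<Longrightarrow> \<not> adjacent (zonotope V) x y"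
  shows "indecomposable (deep_truncation (zonotope V) X)"
proof -
  let ?T = "topes (span V) V"
  have V0: "0 \<notin> V" using V(2) by (simp add: parallelogramic_def)
  have ext: "{u. u extreme_point_of zonotope V} = Sum ` ?T"
    by (rule zonotope_extreme_points[OF V(1) V0])
  have finT: "finite ?T"
    by (rule finite_subset[of _ "Pow V"]) (use topes_subset[of _ "span V" V] V(1) in auto)
  have inj: "inj_on Sum ?T"
    by (rule inj_onI) (rule tope_sum_inj[OF V(1) _ topes_subset])
  define \<X> where "\<X> = {A \<in> ?T. \<Sum>A \<in> X}"
  have \<X>: "\<X> \<subseteq> ?T" by (auto simp: \<X>_def)
  have "card \<X> \<le> card X"
  proof (rule card_inj_on_le)
    show "inj_on Sum \<X>" using inj \<X> by (rule inj_on_subset)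
    show "Sum ` \<X> \<subseteq> X" by (auto simp: \<X>_def)
    show "finite X" using X(1) finT unfolding ext by (rule finite_subset[OF _ finite_imageI])
  qed
  \<comment> \<open>With \<open>d\<close> the dimension, at most \<open>d - 2\<close> removed
    vertices give the strict bound that connectivity needs in dimension \<open>d - 1\<close>, that
    of the projection along a generator.\<close>
  then have card\<X>: "card \<X> + 1 < dim (span V)" and d3: "3 \<le> dim (span V)"
    using X(3) d unfolding aff_dim_zonotope[OF V(1)] by linarith+
  obtain A0 where A0: "A0 \<in> ?T" "x = \<Sum>A0" using X(1,2) ext by blast
  have A0V: "A0 \<subseteq> V" using topes_subset[OF A0(1)] .
  define N where "N v = (if v \<in> A0 then A0 - {v} else insert v A0)" for v
  have N: "N v \<in> ?T" "adjacent (zonotope V) x (\<Sum>(N v))" if "v \<in> V" for v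
    using tope_neighbour[OF V that A0(2,1) inc[OF that]] unfolding N_def by blast+
  \<comment> \<open>No neighbour of \<open>x\<close> is removed, so all of them take part in the
    comparison by \<open>h\<close>.\<close>
  then have NU: "N v \<in> ?T - \<X>" if "v \<in> V" for v using nonadj that by (auto simp: \<X>_def)
  obtain H where H: "affine H" "aff_dim H = aff_dim (zonotope V) - 1" "\<And>y. adjacent (zonotope V) x y \<Longrightarrow> y \<in> H"
    using trunc unfolding admits_deep_truncation_def by blast
  have Hd: "aff_dim H < int (dim (span V))" using H(2) unfolding aff_dim_zonotope[OF V(1)] by simp
  have HN: "\<Sum>(N v) \<in> H" if "v \<in> V" for v using H(3) N(2)[OF that] A0(2) by blast
  have "0 < dim (span V)" using d3 by simp
  from truncation_functional[OF V(1) this A0V N_def H(1) Hd HN]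
  obtain h \<kappa> where h: "\<kappa> > 0" "\<And>v. v \<in> V \<Longrightarrow> h \<bullet> (\<Sum>A0 - \<Sum>(N v)) = \<kappa>" by metis
  let ?U = "Sum ` (?T - \<X>)"
  have U: "finite ?U" "?U \<subseteq> zonotope V"
    using finT by (auto intro: subset_sum_in_zonotope[OF V(1) topes_subset])
  have "V \<noteq> {}" using d3 by auto
  then have Une: "?U \<noteq> {}" using NU by blast
  have "{u. u extreme_point_of zonotope V \<and> u \<notin> X} = {u. u extreme_point_of zonotope V} - X" by auto
  also have "\<dots> = ?U" unfolding ext by (auto simp: \<X>_def)
  finally have P: "deep_truncation (zonotope V) X = convex hull ?U" by (simp add: deep_truncation_def)
  have "\<exists>c t. 0 \<le> c \<and> Q = (\<lambda>x. c *\<^sub>R x + t) ` (convex hull ?U)" if Q: "deformation_of Q (convex hull ?U)" for Q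
  proof -
    obtain q where q: "Q = convex hull (q ` ?U)"
      and max: "\<And>f u y. \<lbrakk>u \<in> ?U; \<And>u'. u' \<in> ?U \<Longrightarrow> f \<bullet> u' \<le> f \<bullet> u; y \<in> Q\<rbrakk> \<Longrightarrow> f \<bullet> y \<le> f \<bullet> q u"
      using deformation_vertex_map[OF U(1) Une Q] by metis
    have qQ: "q (\<Sum>A) \<in> Q" if "A \<in> ?T - \<X>" for A unfolding q using that by (intro hull_inc imageI)
    have "\<exists>c t. 0 \<le> c \<and> (\<forall>A\<in>?T - \<X>. q (\<Sum>A) = t + c *\<^sub>R \<Sum>A)"
    proof (rule vertex_map_affine[OF V d3 \<X> card\<X> A0V N_def NU _ h])
      show "A0 \<in> \<X>" using A0 X(2) by (simp add: \<X>_def)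
      show "q (\<Sum>(insert w A)) - q (\<Sum>A) \<in> span {w}"
        if w: "w \<in> V" "w \<notin> A" and A: "A \<in> ?T - \<X>" "insert w A \<in> ?T - \<X>" for A w
      proof (rule edge_difference_in_span[OF V(1) w _ _ subspace_span])
        show "A \<in> ?T" "insert w A \<in> ?T" using A by blast+
        fix f assume f: "\<And>y. y \<in> zonotope V \<Longrightarrow> f \<bullet> y \<le> f \<bullet> \<Sum>A" "f \<bullet> \<Sum>(insert w A) = f \<bullet> \<Sum>A"
        show "f \<bullet> q (\<Sum>A) = f \<bullet> q (\<Sum>(insert w A))"
        proof (rule antisym)
          show "f \<bullet> q (\<Sum>A) \<le> f \<bullet> q (\<Sum>(insert w A))"
            by (rule max) (use A U(2) f qQ in auto)
          show "f \<bullet> q (\<Sum>(insert w A)) \<le> f \<bullet> q (\<Sum>A)"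
            by (rule max) (use A U(2) f qQ in auto)
        qed
      qed
      show "f \<bullet> q (\<Sum>B) \<le> f \<bullet> q (\<Sum>A)"
        if "A \<in> ?T - \<X>" "B \<in> ?T - \<X>" "\<And>C. C \<in> ?T - \<X> \<Longrightarrow> f \<bullet> \<Sum>C \<le> f \<bullet> \<Sum>A" for f A B
        by (rule max) (use that qQ in auto)
    qed
    then obtain c t where c: "0 \<le> c" and ct: "\<forall>A\<in>?T - \<X>. q (\<Sum>A) = t + c *\<^sub>R \<Sum>A" by blast
    have "q ` ?U = (\<lambda>x. t + c *\<^sub>R x) ` ?U" using ct by (intro image_cong) auto
    then have "Q = (\<lambda>x. t + c *\<^sub>R x) ` (convex hull ?U)" unfolding q by (simp only: convex_hull_affinity)
    then show ?thesis using c by (auto simp: add.commute)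
  qed
  then show ?thesis
    unfolding indecomposable_def P using U(1) Une by (auto simp: polytope_def)
qed

theorem corollary5p1p9:
  fixes V :: "'a::euclidean_space set" and x\<^sub>0 :: 'a
  assumes "finite V"
    and "parallelogramic V"
    and "aff_dim (zonotope V) \<ge> 3"
    and "admits_deep_truncation (zonotope V) x\<^sub>0"
    and "\<forall>v\<in>V. incident_around V v x\<^sub>0"
  shows "indecomposable (deep_truncation (zonotope V) {x\<^sub>0}) \<and>
    (\<forall>X. X \<subseteq> {u. u extreme_point_of zonotope V} \<and> x\<^sub>0 \<in> X \<and>
         int (card X) \<le> aff_dim (zonotope V) - 2 \<and>
         (\<forall>x\<in>X. \<forall>y\<in>X. \<not> adjacent (zonotope V) x y) \<and>
         (\<forall>x\<in>X. admits_deep_truncation (zonotope V) x)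
       \<longrightarrow> indecomposable (deep_truncation (zonotope V) X))"
proof (intro conjI allI impI)
  have "\<not> adjacent (zonotope V) x\<^sub>0 x\<^sub>0" by (simp add: adjacent_def edge_of_def)
  then show "indecomposable (deep_truncation (zonotope V) {x\<^sub>0})"
    using assms by (intro deep_truncation_indecomposable[where x = x\<^sub>0]) (auto simp: admits_deep_truncation_def)
qed (use assms in \<open>blast intro: deep_truncation_indecomposable\<close>)

end
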